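(* Let $\Sigma^+$ be a topologically mixing one-sided countable Markov shift with finite Gurevich entropy. Let $\phi,\psi:\Sigma^+\to\mathbb R$ have summable variations with $\sup\phi<\infty$ and $\|\psi\|_\infty<\infty$, and let $\mathfrak p_{\phi,\psi}(t):=P_G(\phi+t\psi)$, $t\in\mathbb R$. Then: (1) $\mathfrak p_{\phi,\psi}$ is finite, convex and continuous on $\mathbb R$. (2) $\mathfrak p_{\phi,\psi}$ has well-defined finite one-sided derivatives $(D^\pm\mathfrak p_{\phi,\psi})(t)=\lim_{h\to0^\pm}\frac1h[\mathfrak p_{\phi,\psi}(t+h)-\mathfrak p_{\phi,\psi}(t)]$. (3) $\lim_{t\to\infty}(D^\pm\mathfrak p_{\phi,\psi})(t)$ exist, are equal and finite; call the common value $\mathfrak p'_{\phi,\psi}(+\infty)$. Similarly $\lim_{t\to-\infty}(D^\pm\mathfrak p_{\phi,\psi})(t)$ exist, are equal and finite; call it $\mathfrak p'_{\phi,\psi}(-\infty)$. (4) $\mathfrak p'_{\phi,\psi}(+\infty)=\sup\{\int\psi d\mu:\mu\in\mathscr M(\Sigma^+)\}$ and $\mathfrak p'_{\phi,\psi}(-\infty)=\inf\{\int\psi d\mu:\mu\in\mathscr M(\Sigma^+)\}$. (5) If $\psi$ is not cohomologous to a constant by a continuous transfer function, then $\mathfrak p'_{\phi,\psi}(-\infty)<\mathfrak p'_{\phi,\psi}(+\infty)$.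
   Context: One-sided TMS over a countable directed graph with vertices $S$: $\Sigma^+=\{(x_0,x_1,\dots):x_i\to x_{i+1}\}$, left shift $\sigma$; mixing: strongly connected graph with gcd of loop lengths 1. $\mathrm{osc}_n(\phi)=\sup\{|\phi(\underline x)-\phi(\underline y)|:x_i=y_i,i<n\}$; summable variations: $\sum_{n\ge2}\mathrm{osc}_n(\phi)<\infty$. $\phi_n=\sum_{k<n}\phi\circ\sigma^k$; Gurevich pressure $P_G(\phi)=\lim\frac1n\log\sum_{\sigma^n\underline x=\underline x}e^{\phi_n(\underline x)}1_{[a]}(\underline x)$ for any state $a$; Gurevich entropy $P_G(0)$. $\mathscr M(\Sigma^+)$: shift-invariant Borel probability measures. $\psi$ cohomologous to a constant $c$ via a continuous transfer function means $\psi=r-r\circ\sigma+c$ for some continuous $r$. *)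

theory Defs
  imports "HOL-Probability.Probability"
begin

text \<open>The vertex set S is the (countable) type 'a; the edge relation is E, with E a b meaning a \<rightarrow> b.\<close>

definition shift_space :: "('a \<Rightarrow> 'a \<Rightarrow> bool) \<Rightarrow> (nat \<Rightarrow> 'a) set" where
  "shift_space E = {x. \<forall>i. E (x i) (x (Suc i))}"

definition shift :: "(nat \<Rightarrow> 'a) \<Rightarrow> (nat \<Rightarrow> 'a)" where
  "shift x = (\<lambda>i. x (Suc i))"

definition mixing_graph :: "('a \<Rightarrow> 'a \<Rightarrow> bool) \<Rightarrow> bool" where
  "mixing_graph E \<longleftrightarrow> (\<forall>a b. E\<^sup>+\<^sup>+ a b) \<and>
     Gcd {n::nat. n > 0 \<and> (\<exists>a. (E ^^ n) a a)} = 1"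

text \<open>Oscillation (as extended real, so that it may be infinite).\<close>
definition osc :: "('a \<Rightarrow> 'a \<Rightarrow> bool) \<Rightarrow> ((nat \<Rightarrow> 'a) \<Rightarrow> real) \<Rightarrow> nat \<Rightarrow> ereal" where
  "osc E \<phi> n = (SUP p \<in> {(x, y). x \<in> shift_space E \<and> y \<in> shift_space E \<and> (\<forall>i<n. x i = y i)}.
                  ereal \<bar>\<phi> (fst p) - \<phi> (snd p)\<bar>)"

definition summable_variations :: "('a \<Rightarrow> 'a \<Rightarrow> bool) \<Rightarrow> ((nat \<Rightarrow> 'a) \<Rightarrow> real) \<Rightarrow> bool" where
  "summable_variations E \<phi> \<longleftrightarrow> (\<Sum>n. osc E \<phi> (n + 2)) < \<infinity>"

definition birkhoff_sum :: "((nat \<Rightarrow> 'a) \<Rightarrow> real) \<Rightarrow> nat \<Rightarrow> (nat \<Rightarrow> 'a) \<Rightarrow> real" where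
  "birkhoff_sum \<phi> n x = (\<Sum>k<n. \<phi> ((shift ^^ k) x))"

definition partition_fn :: "('a \<Rightarrow> 'a \<Rightarrow> bool) \<Rightarrow> ((nat \<Rightarrow> 'a) \<Rightarrow> real) \<Rightarrow> 'a \<Rightarrow> nat \<Rightarrow> ennreal" where
  "partition_fn E \<phi> a n =
     (\<integral>\<^sup>+ x. ennreal (exp (birkhoff_sum \<phi> n x))
        \<partial>count_space {x \<in> shift_space E. (shift ^^ n) x = x \<and> x 0 = a})"

definition ln_ennreal :: "ennreal \<Rightarrow> ereal" where
  "ln_ennreal z = (if z = 0 then -\<infinity> else if z = \<infinity> then \<infinity> else ereal (ln (enn2real z)))"

definition gurevich_pressure :: "('a \<Rightarrow> 'a \<Rightarrow> bool) \<Rightarrow> ((nat \<Rightarrow> 'a) \<Rightarrow> real) \<Rightarrow> 'a \<Rightarrow> ereal" where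
  "gurevich_pressure E \<phi> a = lim (\<lambda>n. ereal (1 / real n) * ln_ennreal (partition_fn E \<phi> a n))"

definition cylinders :: "('a \<Rightarrow> 'a \<Rightarrow> bool) \<Rightarrow> (nat \<Rightarrow> 'a) set set" where
  "cylinders E = {{x \<in> shift_space E. \<forall>i<n. x i = w i} | n w. True}"

text \<open>Borel sigma-algebra of the shift space (product of discrete topologies on a countable
  alphabet): generated by the cylinder sets.\<close>
definition shift_borel :: "('a \<Rightarrow> 'a \<Rightarrow> bool) \<Rightarrow> (nat \<Rightarrow> 'a) measure" where
  "shift_borel E = sigma (shift_space E) (cylinders E)"

definition invariant_measures :: "('a \<Rightarrow> 'a \<Rightarrow> bool) \<Rightarrow> (nat \<Rightarrow> 'a) measure set" where
  "invariant_measures E = {\<mu>. prob_space \<mu> \<and> sets \<mu> = sets (shift_borel E) \<and>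
      shift \<in> measurable \<mu> \<mu> \<and>
      (\<forall>A \<in> sets \<mu>. emeasure \<mu> (shift -` A \<inter> space \<mu>) = emeasure \<mu> A)}"

text \<open>Continuity on the shift space w.r.t. the product of discrete topologies.\<close>
definition shift_continuous :: "('a \<Rightarrow> 'a \<Rightarrow> bool) \<Rightarrow> ((nat \<Rightarrow> 'a) \<Rightarrow> real) \<Rightarrow> bool" where
  "shift_continuous E r \<longleftrightarrow> (\<forall>x \<in> shift_space E. \<forall>\<epsilon>>0. \<exists>n. \<forall>y \<in> shift_space E.
       (\<forall>i<n. y i = x i) \<longrightarrow> \<bar>r y - r x\<bar> < \<epsilon>)"

definition cohomologous_to_const :: "('a \<Rightarrow> 'a \<Rightarrow> bool) \<Rightarrow> ((nat \<Rightarrow> 'a) \<Rightarrow> real) \<Rightarrow> bool" where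
  "cohomologous_to_const E \<psi> \<longleftrightarrow> (\<exists>r c. shift_continuous E r \<and>
       (\<forall>x \<in> shift_space E. \<psi> x = r x - r (shift x) + c))"

definition right_deriv :: "(real \<Rightarrow> real) \<Rightarrow> real \<Rightarrow> real" where
  "right_deriv p t = Lim (at_right 0) (\<lambda>h. (p (t + h) - p t) / h)"

definition left_deriv :: "(real \<Rightarrow> real) \<Rightarrow> real \<Rightarrow> real" where
  "left_deriv p t = Lim (at_left 0) (\<lambda>h. (p (t + h) - p t) / h)"

end

theory Submission
  imports Defs
begin

text \<open>Finite entropy makes the set of n-periodic points through a given state finite, and bounded
  distortion makes the logarithms of the partition sums almost superadditive, so the pressure is the
  limit of log-sum-exp functions of t and hence convex. Comparing the partition sums with their largest
  and with single terms shows that the slope at infinity is the supremum of the averages of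
  \<open>\<psi>\<close> over periodic orbits; no variational principle is needed. Periodic orbits
  carry invariant measures. Conversely, an orbit segment that mostly stays in a finite set of
  states splits into boundedly many near-loops and few other points, so no invariant measure
  exceeds the periodic averages. If the two slopes coincide, all periodic averages agree, and
  \<open>\<psi>\<close> minus that constant is a coboundary.\<close>

section \<open>Numerical semigroups and superadditive sequences\<close>

text \<open>The obstacle is non-compactness. Mass can escape to infinity along a sequence of
  invariant measures, so the supremum of the integrals may not be attained and no measure can be
  produced as a weak limit. Hence the pressure is bounded below by a line for each slope strictly
  below the supremum, each with its own constant, while a single line of the exact slope bounds it
  above. Escape of mass is controlled for one measure at a time: the error constant depends on the
  finite set of states, but it disappears on division by the length of the orbit segment, after
  which the finite set can grow. \<open>\<phi>\<close> may be unbounded below; the lower bound meets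
  it only through its Birkhoff sum over one chosen loop, and the upper bound only through the
  pressure at 0. Concatenating and closing orbits costs a fixed distortion constant. The decay of
  distortion under longer overlaps is what makes \<open>\<psi>\<close> and the transfer function
  continuous and the coboundary equation exact. Behaviour at minus infinity comes from replacing
  \<open>\<psi>\<close> by its negative.\<close>

lemma eventually_in_numerical_semigroup:
  fixes L :: "nat set"
  assumes add: "\<And>m n. m \<in> L \<Longrightarrow> n \<in> L \<Longrightarrow> m + n \<in> L"
    and Gcd: "Gcd L = 1"
  shows "\<exists>N. \<forall>n\<ge>N. n \<in> L"
proof -
  define L0 where "L0 = insert 0 L"
  have add0: "m + n \<in> L0" if "m \<in> L0" "n \<in> L0" for m n
    using that add by (auto simp: L0_def)
  have mult0: "k * n \<in> L0" if "n \<in> L0" for k n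
    using that by (induction k) (auto simp: add0, auto simp: L0_def)
  \<comment> \<open>\<open>P d\<close> says that \<open>d\<close> is a gap between two elements of
    the semigroup. The least gap divides every element, hence is 1, which yields two consecutive
    elements.\<close>
  define P where "P d \<longleftrightarrow> d > 0 \<and> (\<exists>y. y \<in> L0 \<and> y + d \<in> L0)" for d
  obtain n0 where n0: "n0 \<in> L" "n0 > 0"
    using Gcd by (metis Gcd_0_iff One_nat_def gr0I insertCI subsetI zero_neq_one)
  have "P n0"
    using n0 by (auto simp: P_def L0_def)
  define d where "d = (LEAST d. P d)"
  have Pd: "P d"
    unfolding d_def using \<open>P n0\<close> by (rule LeastI)
  have min: "d \<le> e" if "P e" for e
    unfolding d_def using that by (rule Least_le)
  obtain y where y: "y \<in> L0" "y + d \<in> L0" and "d > 0"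
    using Pd by (auto simp: P_def)
  have "d dvd n" if "n \<in> L" for n
  proof (rule ccontr)
    assume nd: "\<not> d dvd n"
    define r where "r = n mod d"
    define q where "q = n div d"
    have r: "r > 0" "r < d"
      using nd \<open>d > 0\<close> by (auto simp: r_def dvd_eq_mod_eq_0)
    have "n = q * d + r"
      by (simp add: q_def r_def)
    \<comment> \<open>A nonzero remainder \<open>r\<close> would itself be a gap, between
      \<open>q * (y + d)\<close> and \<open>n + q * y\<close>, and smaller than the least
      one.\<close>
    hence "q * (y + d) + r = n + q * y"
      by (simp add: algebra_simps)
    moreover have "n + q * y \<in> L0"
      using that y by (intro add0 mult0) (auto simp: L0_def)
    ultimately have "P r"
      unfolding P_def using r mult0[OF y(2), of q] by metis
    thus False
      using min r by fastforce
  qed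
  hence "d dvd Gcd L"
    by (rule Gcd_greatest)
  hence "d = 1"
    using Gcd by simp
  have "n \<in> L0" if "n \<ge> y * y" for n
  proof (cases "y = 0")
    case True
    thus ?thesis
      using mult0[OF y(2), of n] \<open>d = 1\<close> by simp
  next
    case False
    define q where "q = n div y"
    define r where "r = n mod y"
    have "r < y" "n = q * y + r"
      using False by (auto simp: q_def r_def)
    moreover have "y \<le> q"
      using that False by (simp add: q_def less_eq_div_iff_mult_less_eq)
    ultimately have "n = (q - r) * y + r * (y + d)"
      using \<open>d = 1\<close> by (simp add: algebra_simps diff_mult_distrib)
    thus ?thesis
      using y by (auto intro: add0 mult0)
  qed
  hence "n \<in> L" if "n \<ge> y * y + 1" for n
    using that unfolding L0_def by (metis Suc_eq_plus1 Suc_leD insertE not_less_eq_eq zero_le)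
  thus ?thesis by blast
qed

lemma superadditive_mult_le:
  fixes u :: "nat \<Rightarrow> real"
  assumes super: "\<And>n m. n \<ge> N \<Longrightarrow> m \<ge> N \<Longrightarrow> u n + u m \<le> u (n + m)"
    and "n \<ge> N" "r \<ge> N"
  shows "real q * u n + u r \<le> u (q * n + r)"
proof (induction q)
  case (Suc q)
  have "u n + u (q * n + r) \<le> u (n + (q * n + r))"
    using assms by (intro super) auto
  thus ?case
    using Suc by (simp add: algebra_simps)
qed simp

text \<open>Fekete's lemma with superadditivity known only from \<open>N\<close> on, because loops
  of small length may not exist.\<close>

lemma superadditive_limit:
  fixes u :: "nat \<Rightarrow> real"
  assumes "N > 0"
    and super: "\<And>n m. n \<ge> N \<Longrightarrow> m \<ge> N \<Longrightarrow> u n + u m \<le> u (n + m)"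
  shows "(\<lambda>n. ereal (u n / real n)) \<longlonglongrightarrow> (SUP n\<in>{N..}. ereal (u n / real n))"
proof (rule order_tendstoI)
  fix c assume "c < (SUP n\<in>{N..}. ereal (u n / real n))"
  then obtain n where n: "n \<ge> N" "c < ereal (u n / real n)"
    by (auto simp: less_SUP_iff)
  then obtain d where d: "c < ereal d" "d < u n / real n"
    using ereal_dense2[OF n(2)] by auto
  have "n > 0" using n assms by simp
  define e where "e = u n / real n - d"
  have "e > 0" using d by (simp add: e_def)
  define B where "B = (\<Sum>r\<in>{N..<N+n}. \<bar>u r\<bar>) + (real N + real n) * \<bar>u n / real n\<bar>"
  have bound: "u n / real n * real m - B \<le> u m" if m: "m \<ge> N" for m
  proof -
    define q where "q = (m - N) div n"
    \<comment> \<open>The remainder is taken in \<open>{N..<N+n}\<close> instead of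
      \<open>{..<n}\<close>, so that superadditivity applies to it too; \<open>B\<close> absorbs the
      values of \<open>u\<close> on this window.\<close>
    define r where "r = N + (m - N) mod n"
    have r: "r \<in> {N..<N+n}" using \<open>n > 0\<close> by (auto simp: r_def)
    have mq: "m = q * n + r" using m by (simp add: q_def r_def)
    have "real q * u n + u r \<le> u m"
      unfolding mq using r n by (intro superadditive_mult_le[OF super]) auto
    moreover have "\<bar>u r\<bar> \<le> (\<Sum>r\<in>{N..<N+n}. \<bar>u r\<bar>)"
      using r by (intro member_le_sum) auto
    moreover have "real q * u n = u n / real n * real m - u n / real n * real r"
      unfolding mq using \<open>n > 0\<close> by (simp add: field_simps)
    moreover have "u n / real n * real r \<le> \<bar>u n / real n\<bar> * (real N + real n)"
      using r by (intro mult_mono abs_ge_self) auto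
    ultimately show ?thesis unfolding B_def by (simp add: algebra_simps)
  qed
  have "(\<lambda>m. B / real m) \<longlonglongrightarrow> 0"
    by (intro tendsto_divide_0[OF tendsto_const] filterlim_at_top_imp_at_infinity
        filterlim_real_sequentially)
  hence "eventually (\<lambda>m. B / real m < e) sequentially"
    using \<open>e > 0\<close> by (rule order_tendstoD)
  thus "eventually (\<lambda>m. c < ereal (u m / real m)) sequentially"
    using eventually_ge_at_top[of N]
  proof eventually_elim
    case (elim m)
    have "m > 0" using elim assms by simp
    have "(u n / real n * real m - B) / real m \<le> u m / real m"
      using bound[OF elim(2)] by (rule divide_right_mono) simp
    moreover have "(u n / real n * real m - B) / real m = u n / real n - B / real m"
      using \<open>m > 0\<close> by (simp add: diff_divide_distrib)
    ultimately have "d \<le> u m / real m"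
      using elim by (simp add: e_def)
    thus ?case
      using d(1) by (metis ereal_less_eq(3) less_le_trans)
  qed
next
  fix c assume c: "(SUP n\<in>{N..}. ereal (u n / real n)) < c"
  show "eventually (\<lambda>m. ereal (u m / real m) < c) sequentially"
    using eventually_ge_at_top[of N]
  proof eventually_elim
    case (elim m)
    hence "ereal (u m / real m) \<le> (SUP n\<in>{N..}. ereal (u n / real n))"
      by (intro SUP_upper) auto
    thus ?case using c by simp
  qed
qed

section \<open>Convexity\<close>

text \<open>Hoelder's inequality in logarithmic form: after both sums are normalised to 1, convexity
  of the exponential applies term by term.\<close>

lemma sum_exp_convex_combination_le:
  fixes f g :: "'b \<Rightarrow> real"
  assumes "finite A" "A \<noteq> {}" "0 \<le> u" "0 \<le> v" "u + v = 1"
  shows "ln (\<Sum>x\<in>A. exp (u * f x + v * g x))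
    \<le> u * ln (\<Sum>x\<in>A. exp (f x)) + v * ln (\<Sum>x\<in>A. exp (g x))"
proof -
  define a where "a = (\<Sum>x\<in>A. exp (f x))"
  define b where "b = (\<Sum>x\<in>A. exp (g x))"
  have pos: "a > 0" "b > 0"
    unfolding a_def b_def using assms by (auto intro!: sum_pos)
  have cvx: "convex_on UNIV (\<lambda>x::real. exp (1 * x))"
    by (rule convex_on_exp) simp
  have "exp (u * f x + v * g x - (u * ln a + v * ln b))
      \<le> u * (exp (f x) / a) + v * (exp (g x) / b)" for x
  proof -
    have "exp (u * (f x - ln a) + v * (g x - ln b)) \<le> u * exp (f x - ln a) + v * exp (g x - ln b)"
      using cvx assms unfolding convex_on_def by auto
    thus ?thesis using pos by (simp add: exp_diff algebra_simps)
  qed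
  hence "(\<Sum>x\<in>A. exp (u * f x + v * g x - (u * ln a + v * ln b)))
      \<le> (\<Sum>x\<in>A. u * (exp (f x) / a) + v * (exp (g x) / b))"
    by (rule sum_mono)
  also have "\<dots> = u * (a / a) + v * (b / b)"
    unfolding sum.distrib sum_distrib_left[symmetric] sum_divide_distrib[symmetric]
    by (simp add: a_def b_def)
  also have "\<dots> = 1" using pos assms by simp
  finally have "(\<Sum>x\<in>A. exp (u * f x + v * g x)) \<le> exp (u * ln a + v * ln b)"
    by (simp add: exp_diff sum_divide_distrib[symmetric])
  moreover have "(\<Sum>x\<in>A. exp (u * f x + v * g x)) > 0"
    using assms by (auto intro!: sum_pos)
  ultimately show ?thesis
    unfolding a_def[symmetric] b_def[symmetric]
    by (metis ln_exp ln_le_cancel_iff exp_gt_zero)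
qed

lemma convex_difference_quotient_mono:
  fixes p :: "real \<Rightarrow> real"
  assumes cvx: "convex_on UNIV p" and "h \<noteq> 0" "k \<noteq> 0" "h \<le> k"
  shows "(p (t + h) - p t) / h \<le> (p (t + k) - p t) / k"
proof (cases "h = k")
  case False
  hence "h < k" using assms by simp
  consider "0 < h" | "h < 0" "0 < k" | "k < 0" using assms by linarith
  thus ?thesis
  proof cases
    case 1
    show ?thesis
      using convex_on_slope_le(1)[OF cvx, of t "t + k" "t + h"] 1 \<open>h < k\<close> by (simp add: diff_divide_distrib)
  next
    case 2
    have "(p (t + h) - p t) / h \<le> (p (t + h) - p (t + k)) / (t + h - (t + k))"
      using convex_on_slope_le(1)[OF cvx, of "t + h" "t + k" t] 2 by simp
    also have "\<dots> \<le> (p (t + k) - p t) / k"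
      using convex_on_slope_le(2)[OF cvx, of "t + h" "t + k" t] 2 by (simp add: diff_divide_distrib)
    finally show ?thesis .
  next
    case 3
    show ?thesis
      using convex_on_slope_le(2)[OF cvx, of "t + h" t "t + k"] 3 \<open>h < k\<close> by simp
  qed
qed simp

text \<open>Difference quotients increase in \<open>h\<close> across 0. The limit from the right is
  therefore their infimum over positive \<open>h\<close>, and the quotient at -1 is a lower bound
  that makes this infimum finite.\<close>

lemma convex_right_deriv:
  fixes p :: "real \<Rightarrow> real"
  assumes "convex_on UNIV p"
  shows "((\<lambda>h. (p (t + h) - p t) / h) \<longlongrightarrow> right_deriv p t) (at_right 0)"
    and "h < 0 \<Longrightarrow> (p (t + h) - p t) / h \<le> right_deriv p t"
    and "h > 0 \<Longrightarrow> right_deriv p t \<le> (p (t + h) - p t) / h"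
proof -
  let ?q = "\<lambda>h. (p (t + h) - p t) / h"
  have "(?q \<longlongrightarrow> Inf (?q ` ({0<..} \<inter> UNIV))) (at 0 within ({0<..} \<inter> UNIV))"
    by (rule Lim_right_bound[where K = "?q (-1)"])
      (rule convex_difference_quotient_mono[OF assms]; simp)+
  hence lim: "(?q \<longlongrightarrow> Inf (?q ` {0<..})) (at_right 0)"
    by simp
  hence eq: "right_deriv p t = Inf (?q ` {0<..})"
    unfolding right_deriv_def by (intro tendsto_Lim) auto
  show l: "(?q \<longlongrightarrow> right_deriv p t) (at_right 0)"
    using lim eq by simp
  show "?q h \<le> right_deriv p t" if "h < 0" for h
    unfolding eq using that
    by (intro cINF_greatest) (auto intro!: convex_difference_quotient_mono[OF assms])
  show "right_deriv p t \<le> ?q h" if "h > 0" for h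
    unfolding eq using that
    by (intro cINF_lower bdd_belowI2[where m = "?q (-1)"]
        convex_difference_quotient_mono[OF assms]) auto
qed

lemma convex_on_reflect:
  fixes p :: "real \<Rightarrow> real"
  assumes "convex_on UNIV p"
  shows "convex_on UNIV (\<lambda>t. p (- t))"
proof -
  have "p (u * (- x) + v * (- y)) \<le> u * p (- x) + v * p (- y)"
    if "0 \<le> u" "0 \<le> v" "u + v = 1" for u v x y :: real
    using assms that unfolding convex_on_def real_scaleR_def by blast
  thus ?thesis unfolding convex_on_def by simp
qed

lemma convex_left_deriv_reflect:
  fixes p :: "real \<Rightarrow> real"
  assumes "convex_on UNIV p"
  shows "((\<lambda>h. (p (t + h) - p t) / h) \<longlongrightarrow> left_deriv p t) (at_left 0)"
    and "left_deriv p t = - right_deriv (\<lambda>s. p (- s)) (- t)"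
proof -
  have "((\<lambda>h. - ((p (- (- t + h)) - p t) / h)) \<longlongrightarrow> - right_deriv (\<lambda>s. p (- s)) (- t)) (at_right 0)"
    using convex_right_deriv(1)[OF convex_on_reflect[OF assms], of "- t"]
    by (intro tendsto_minus) simp
  hence *: "((\<lambda>h. (p (t + h) - p t) / h) \<longlongrightarrow> - right_deriv (\<lambda>s. p (- s)) (- t)) (at_left 0)"
    by (simp add: filterlim_at_left_to_right)
  show eq: "left_deriv p t = - right_deriv (\<lambda>s. p (- s)) (- t)"
    unfolding left_deriv_def using * by (intro tendsto_Lim) auto
  show "((\<lambda>h. (p (t + h) - p t) / h) \<longlongrightarrow> left_deriv p t) (at_left 0)"
    using * eq by simp
qed

lemma convex_left_deriv_bounds:
  fixes p :: "real \<Rightarrow> real"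
  assumes "convex_on UNIV p"
  shows "left_deriv p t \<le> right_deriv p t"
    and "h > 0 \<Longrightarrow> (p t - p (t - h)) / h \<le> left_deriv p t"
proof -
  show "(p t - p (t - h)) / h \<le> left_deriv p t" if "h > 0" for h
    using convex_right_deriv(3)[OF convex_on_reflect[OF assms] that, of "- t"] that
    unfolding convex_left_deriv_reflect(2)[OF assms] by (simp add: field_simps)
  have "eventually (\<lambda>h. (p (t + h) - p t) / h \<le> right_deriv p t) (at_left 0)"
    using convex_right_deriv(2)[OF assms] by (auto simp: eventually_at_filter)
  thus "left_deriv p t \<le> right_deriv p t"
    by (intro tendsto_upperbound[OF convex_left_deriv_reflect(1)[OF assms]]) auto
qed

text \<open>The right derivative at \<open>t\<close> is at most the slope of every chord from
  \<open>t\<close> to the right, and long chords below the upper line have slope at most about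
  \<open>\<beta>\<close>. The left derivative at \<open>t\<close> is at least the slope of the chord
  from 0 to \<open>t\<close>, which the lower lines push above any number below
  \<open>\<beta>\<close>.\<close>

lemma convex_asymptotic_slope:
  fixes p :: "real \<Rightarrow> real"
  assumes cvx: "convex_on UNIV p"
    and upper: "\<And>t. t \<ge> 0 \<Longrightarrow> p t \<le> c + \<beta> * t"
    and lower: "\<And>\<beta>'. \<beta>' < \<beta> \<Longrightarrow> \<exists>c'. \<forall>t\<ge>0. c' + \<beta>' * t \<le> p t"
  shows "(right_deriv p \<longlongrightarrow> \<beta>) at_top" "(left_deriv p \<longlongrightarrow> \<beta>) at_top"
proof -
  have right: "right_deriv p t \<le> \<beta>" for t
  proof (rule tendsto_le[OF trivial_limit_at_top_linorder])
    show "((\<lambda>h. right_deriv p t) \<longlongrightarrow> right_deriv p t) (at_top :: real filter)" by simp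
    have "((\<lambda>h. \<beta> + (c + \<beta> * t - p t) / h) \<longlongrightarrow> \<beta> + 0) (at_top :: real filter)"
      by (intro tendsto_intros tendsto_divide_0[OF tendsto_const]
          filterlim_at_top_imp_at_infinity filterlim_ident)
    thus "((\<lambda>h. \<beta> + (c + \<beta> * t - p t) / h) \<longlongrightarrow> \<beta>) (at_top :: real filter)" by simp
    show "eventually (\<lambda>h. right_deriv p t \<le> \<beta> + (c + \<beta> * t - p t) / h) at_top"
      using eventually_gt_at_top[of "max 0 (- t)"]
    proof eventually_elim
      case (elim h)
      have "right_deriv p t \<le> (p (t + h) - p t) / h"
        using elim by (intro convex_right_deriv[OF cvx]) auto
      also have "\<dots> \<le> (c + \<beta> * (t + h) - p t) / h"
        using elim upper[of "t + h"] by (intro divide_right_mono) auto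
      also have "\<dots> = \<beta> + (c + \<beta> * t - p t) / h" using elim by (simp add: field_simps)
      finally show ?case .
    qed
  qed
  have left: "eventually (\<lambda>t. b < left_deriv p t) at_top" if "b < \<beta>" for b
  proof -
    obtain \<beta>' where b: "b < \<beta>'" "\<beta>' < \<beta>" using dense[OF \<open>b < \<beta>\<close>] by blast
    then obtain c' where c': "\<And>t. t \<ge> 0 \<Longrightarrow> c' + \<beta>' * t \<le> p t" using lower by blast
    have "((\<lambda>t. \<beta>' + (c' - p 0) / t) \<longlongrightarrow> \<beta>' + 0) (at_top :: real filter)"
      by (intro tendsto_intros tendsto_divide_0[OF tendsto_const]
          filterlim_at_top_imp_at_infinity filterlim_ident)
    hence "eventually (\<lambda>t. b < \<beta>' + (c' - p 0) / t) (at_top :: real filter)"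
      using b by (intro order_tendstoD) auto
    thus ?thesis
      using eventually_gt_at_top[of 0]
    proof eventually_elim
      case (elim t)
      have "\<beta>' + (c' - p 0) / t = (c' + \<beta>' * t - p 0) / t" using elim by (simp add: field_simps)
      also have "\<dots> \<le> (p t - p 0) / t" using elim c'[of t] by (intro divide_right_mono) auto
      also have "\<dots> \<le> left_deriv p t"
        using convex_left_deriv_bounds(2)[OF cvx, of t t] elim by simp
      finally show ?case using elim by simp
    qed
  qed
  show "(right_deriv p \<longlongrightarrow> \<beta>) at_top"
  proof (rule order_tendstoI)
    fix b assume "b < \<beta>"
    from left[OF this] show "eventually (\<lambda>t. b < right_deriv p t) at_top"
      by eventually_elim (rule less_le_trans[OF _ convex_left_deriv_bounds(1)[OF cvx]])
  next
    fix b assume "\<beta> < b"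
    hence "right_deriv p t < b" for t using right[of t] by linarith
    thus "eventually (\<lambda>t. right_deriv p t < b) at_top" by simp
  qed
  show "(left_deriv p \<longlongrightarrow> \<beta>) at_top"
  proof (rule order_tendstoI)
    fix b assume "\<beta> < b"
    hence "left_deriv p t < b" for t
      using right[of t] convex_left_deriv_bounds(1)[OF cvx, of t] by linarith
    thus "eventually (\<lambda>t. left_deriv p t < b) at_top" by simp
  qed (rule left)
qed

lemma convex_derivs_at_bot:
  fixes p :: "real \<Rightarrow> real"
  assumes cvx: "convex_on UNIV p"
    and "(right_deriv (\<lambda>t. p (- t)) \<longlongrightarrow> \<beta>) at_top" "(left_deriv (\<lambda>t. p (- t)) \<longlongrightarrow> \<beta>) at_top"
  shows "(right_deriv p \<longlongrightarrow> - \<beta>) at_bot" "(left_deriv p \<longlongrightarrow> - \<beta>) at_bot"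
proof -
  have "right_deriv p (- t) = - left_deriv (\<lambda>t. p (- t)) t" for t
    using convex_left_deriv_reflect(2)[OF convex_on_reflect[OF cvx], of t] by simp
  thus "(right_deriv p \<longlongrightarrow> - \<beta>) at_bot"
    using tendsto_minus[OF assms(3)] by (simp add: filterlim_at_bot_mirror)
  show "(left_deriv p \<longlongrightarrow> - \<beta>) at_bot"
    using tendsto_minus[OF assms(2)]
    by (simp add: filterlim_at_bot_mirror convex_left_deriv_reflect(2)[OF cvx])
qed

section \<open>Gluing and closing orbits\<close>

definition glue :: "nat \<Rightarrow> (nat \<Rightarrow> 'a) \<Rightarrow> (nat \<Rightarrow> 'a) \<Rightarrow> nat \<Rightarrow> 'a" where
  "glue n x y = (\<lambda>i. if i < n then x i else y (i - n))"

definition periodize :: "nat \<Rightarrow> (nat \<Rightarrow> 'a) \<Rightarrow> nat \<Rightarrow> 'a" where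
  "periodize n x = (\<lambda>i. x (i mod n))"

text \<open>The index set of the partition sum. The period \<open>n\<close> need not be minimal, and
  the orbit may pass through \<open>a\<close> in between.\<close>

definition loops :: "('a \<Rightarrow> 'a \<Rightarrow> bool) \<Rightarrow> 'a \<Rightarrow> nat \<Rightarrow> (nat \<Rightarrow> 'a) set" where
  "loops E a n = {x \<in> shift_space E. (shift ^^ n) x = x \<and> x 0 = a}"

lemma funpow_shift: "(shift ^^ n) x = (\<lambda>i. x (i + n))"
  by (induction n) (auto simp: shift_def)

lemma shift_space_edge: "x \<in> shift_space E \<Longrightarrow> E (x i) (x (Suc i))"
  by (simp add: shift_space_def)

lemma funpow_shift_in_shift_space: "x \<in> shift_space E \<Longrightarrow> (shift ^^ n) x \<in> shift_space E"
  by (simp add: shift_space_def funpow_shift)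

lemma shift_in_shift_space: "x \<in> shift_space E \<Longrightarrow> shift x \<in> shift_space E"
  using funpow_shift_in_shift_space[of x E 1] by simp

lemma birkhoff_sum_0 [simp]: "birkhoff_sum f 0 x = 0"
  by (simp add: birkhoff_sum_def)

lemma birkhoff_sum_1 [simp]: "birkhoff_sum f (Suc 0) x = f x"
  by (simp add: birkhoff_sum_def)

lemma birkhoff_sum_add:
  "birkhoff_sum f (m + n) x = birkhoff_sum f m x + birkhoff_sum f n ((shift ^^ m) x)"
proof -
  have "birkhoff_sum f (m + n) x = birkhoff_sum f m x + (\<Sum>k<n. f ((shift ^^ (m + k)) x))"
    unfolding birkhoff_sum_def by (induction n) (auto simp: algebra_simps)
  thus ?thesis
    by (simp add: birkhoff_sum_def funpow_shift add_ac)
qed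

lemma birkhoff_sum_linear:
  "birkhoff_sum (\<lambda>x. f x + t * g x) n x = birkhoff_sum f n x + t * birkhoff_sum g n x"
  by (simp add: birkhoff_sum_def sum.distrib sum_distrib_left)

lemma birkhoff_sum_minus: "birkhoff_sum (\<lambda>x. - f x) n x = - birkhoff_sum f n x"
  by (simp add: birkhoff_sum_def sum_negf)

lemma birkhoff_sum_diff_const:
  "birkhoff_sum (\<lambda>x. f x - c) n x = birkhoff_sum f n x - real n * c"
  by (simp add: birkhoff_sum_def sum_subtractf)

lemma birkhoff_sum_le:
  assumes "x \<in> shift_space E" "\<And>y. y \<in> shift_space E \<Longrightarrow> f y \<le> C"
  shows "birkhoff_sum f n x \<le> real n * C"
  unfolding birkhoff_sum_def
  using sum_bounded_above[of "{..<n}" "\<lambda>k. f ((shift ^^ k) x)" C]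
    assms(2)[OF funpow_shift_in_shift_space[OF assms(1)]] by simp

lemma birkhoff_sum_abs_le:
  assumes "x \<in> shift_space E" "\<And>y. y \<in> shift_space E \<Longrightarrow> \<bar>f y\<bar> \<le> C"
  shows "\<bar>birkhoff_sum f n x\<bar> \<le> real n * C"
proof -
  have "f y \<le> C" "- f y \<le> C" if "y \<in> shift_space E" for y
    using assms(2)[OF that] by auto
  thus ?thesis
    using birkhoff_sum_le[OF assms(1), of f C n] birkhoff_sum_le[OF assms(1), of "\<lambda>y. - f y" C n]
    by (simp add: birkhoff_sum_minus abs_le_iff)
qed

lemma birkhoff_sum_periodic_mult:
  assumes "(shift ^^ n) x = x"
  shows "birkhoff_sum f (k * n) x = real k * birkhoff_sum f n x"
  by (induction k) (auto simp: birkhoff_sum_add assms algebra_simps)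

lemma glue_in_shift_space:
  assumes "x \<in> shift_space E" "y \<in> shift_space E" "x n = y 0"
  shows "glue n x y \<in> shift_space E"
  unfolding shift_space_def
proof (intro CollectI allI)
  fix i
  consider "Suc i < n" | "Suc i = n" | "i \<ge> n" by linarith
  thus "E (glue n x y i) (glue n x y (Suc i))"
  proof cases
    case 2
    hence "glue n x y (Suc i) = x (Suc i)" using assms by (simp add: glue_def)
    thus ?thesis using 2 shift_space_edge[OF assms(1), of i] by (simp add: glue_def)
  qed (use assms in \<open>auto simp: glue_def Suc_diff_le shift_space_edge\<close>)
qed

lemma funpow_shift_glue [simp]: "(shift ^^ n) (glue n x y) = y"
  by (simp add: funpow_shift glue_def)

lemma glue_add [simp]: "glue n x y (n + i) = y i"
  by (simp add: glue_def)

text \<open>If \<open>y\<close> starts with the same \<open>k\<close> symbols with which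
  \<open>x\<close> continues after time \<open>n\<close>, the agreement of the glued sequence with
  \<open>x\<close> lasts \<open>k\<close> symbols beyond the junction. This overlap turns the
  distortion constant into a small one.\<close>

lemma glue_agree:
  assumes "\<And>i. i < k \<Longrightarrow> x (n + i) = y i" "i < n + k"
  shows "glue n x y i = x i"
  using assms(1)[of "i - n"] assms(2) by (cases "i < n") (auto simp: glue_def)

lemma glue_agree_Suc:
  assumes "x n = y 0" "i < n + Suc 0"
  shows "glue n x y i = x i"
  using assms by (intro glue_agree[of "Suc 0"]) auto

lemma glue_0: "x n = y 0 \<Longrightarrow> glue n x y 0 = x 0"
  by (auto simp: glue_def)

lemma periodize_in_shift_space:
  assumes "n > 0" "x n = x 0" "\<And>i. i < n \<Longrightarrow> E (x i) (x (Suc i))"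
  shows "periodize n x \<in> shift_space E"
  unfolding shift_space_def periodize_def
proof (intro CollectI allI)
  fix i
  have "x (Suc i mod n) = x (Suc (i mod n))"
    using assms(2) by (simp add: mod_Suc)
  thus "E (x (i mod n)) (x (Suc i mod n))"
    using assms(3)[of "i mod n"] assms(1) by simp
qed

lemma periodize_in_loops:
  assumes "n > 0" "x n = x 0" "x \<in> shift_space E"
  shows "periodize n x \<in> loops E (x 0) n"
  using periodize_in_shift_space[of n x E] assms shift_space_edge[of x E]
  by (auto simp: loops_def periodize_def funpow_shift)

text \<open>The overlap \<open>k\<close> may exceed the period \<open>n\<close>, so the agreement is
  carried along one period at a time.\<close>

lemma periodize_agree:
  assumes "n > 0" "\<And>i. i < k \<Longrightarrow> x (n + i) = x i" "i < n + k"
  shows "periodize n x i = x i"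
  using assms(3)
proof (induction i rule: less_induct)
  case (less i)
  show ?case
  proof (cases "i < n")
    case False
    have "periodize n x i = periodize n x (i - n)"
      using False by (simp add: periodize_def le_mod_geq)
    also have "\<dots> = x (i - n)" using less False assms(1) by (intro less.IH) auto
    also have "\<dots> = x i" using assms(2)[of "i - n"] less.prems False by simp
    finally show ?thesis .
  qed (simp add: periodize_def)
qed

lemma periodize_agree_Suc:
  assumes "n > 0" "x n = x 0" "i < n + Suc 0"
  shows "periodize n x i = x i"
  using assms by (intro periodize_agree[of n "Suc 0"]) auto

lemma loopsD:
  assumes "x \<in> loops E a n"
  shows "x \<in> shift_space E" "(shift ^^ n) x = x" "x 0 = a" "x n = a" "x (i + n) = x i"
proof -
  show "x \<in> shift_space E" and *: "(shift ^^ n) x = x" "x 0 = a"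
    using assms by (auto simp: loops_def)
  show "x (i + n) = x i" for i using fun_cong[OF *(1), of i] by (simp add: funpow_shift)
  from this[of 0] show "x n = a" using * by simp
qed

lemma loops_eqI:
  assumes "x \<in> loops E a n" "y \<in> loops E b n" "\<And>i. i < n \<Longrightarrow> x i = y i" "n > 0"
  shows "x = y"
proof
  fix i show "x i = y i"
  proof (induction i rule: less_induct)
    case (less i)
    show ?case
    proof (cases "i < n")
      case False
      thus ?thesis
        using less[of "i - n"] loopsD(5)[OF assms(1), of "i - n"]
          loopsD(5)[OF assms(2), of "i - n"] assms(4) by simp
    qed (use assms in auto)
  qed
qed

lemma periodize_glue_in_loops:
  assumes "x \<in> loops E a n" "y \<in> loops E a m" "n > 0" "m > 0"
  shows "periodize (n + m) (glue n x y) \<in> loops E a (n + m)"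
proof -
  have "glue n x y \<in> shift_space E"
    using loopsD(1,4)[OF assms(1)] loopsD(1,3)[OF assms(2)] by (intro glue_in_shift_space) auto
  moreover have "glue n x y 0 = a" "glue n x y (n + m) = a"
    using loopsD(3,4)[OF assms(1)] loopsD(3,4)[OF assms(2)] by (simp_all add: glue_0)
  ultimately show ?thesis
    using periodize_in_loops[of "n + m" "glue n x y" E] assms by simp
qed

text \<open>Both lengths are fixed, so the two loops can be read off from the positions. Thus a
  product of two partition sums embeds into a single one.\<close>

lemma inj_on_periodize_glue:
  assumes "n > 0" "m > 0"
  shows "inj_on (\<lambda>(x, y). periodize (n + m) (glue n x y)) (loops E a n \<times> loops E a m)"
proof (rule inj_onI, clarsimp)
  fix x y x' y'
  assume loops: "x \<in> loops E a n" "y \<in> loops E a m" "x' \<in> loops E a n" "y' \<in> loops E a m"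
    and eq: "periodize (n + m) (glue n x y) = periodize (n + m) (glue n x' y')"
  have *: "glue n x y i = glue n x' y' i" if "i < n + m" for i
    using fun_cong[OF eq, of i] that by (simp add: periodize_def)
  have "x i = x' i" if "i < n" for i
    using *[of i] that by (simp add: glue_def)
  moreover have "y i = y' i" if "i < m" for i
    using *[of "n + i"] that by simp
  ultimately show "x = x' \<and> y = y'"
    using loops_eqI assms loops by metis
qed

section \<open>Bounded distortion\<close>

text \<open>The bound is uniform in the length \<open>n\<close> of the sum and depends only on the
  number of symbols shared beyond it. That number is \<open>Suc k\<close>, so at least one: the last
  summand then sees two common symbols, and summable variations control oscillations only from index
  2 on.\<close>

definition distortion_bound ::
    "('a \<Rightarrow> 'a \<Rightarrow> bool) \<Rightarrow> ((nat \<Rightarrow> 'a) \<Rightarrow> real) \<Rightarrow> (nat \<Rightarrow> real) \<Rightarrow> bool" where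
  "distortion_bound E f T \<longleftrightarrow> (\<forall>n k. \<forall>x\<in>shift_space E. \<forall>y\<in>shift_space E.
     (\<forall>i<n + Suc k. x i = y i) \<longrightarrow> \<bar>birkhoff_sum f n x - birkhoff_sum f n y\<bar> \<le> T k)"

lemma distortion_boundD:
  assumes "distortion_bound E f T" "x \<in> shift_space E" "y \<in> shift_space E"
    "\<And>i. i < n + Suc k \<Longrightarrow> x i = y i"
  shows "\<bar>birkhoff_sum f n x - birkhoff_sum f n y\<bar> \<le> T k"
  using assms unfolding distortion_bound_def by blast

lemma distortion_bound_linear:
  assumes f: "distortion_bound E f T" and g: "distortion_bound E g U"
  shows "distortion_bound E (\<lambda>x. f x + t * g x) (\<lambda>k. T k + \<bar>t\<bar> * U k)"
  unfolding distortion_bound_def birkhoff_sum_linear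
proof (intro allI ballI impI)
  fix n k x y
  assume xy: "x \<in> shift_space E" "y \<in> shift_space E" "\<forall>i<n + Suc k. x i = y i"
  have "\<bar>birkhoff_sum f n x - birkhoff_sum f n y\<bar> \<le> T k"
    using xy by (intro distortion_boundD[OF f]) auto
  moreover have "\<bar>t\<bar> * \<bar>birkhoff_sum g n x - birkhoff_sum g n y\<bar> \<le> \<bar>t\<bar> * U k"
    using xy by (intro mult_left_mono distortion_boundD[OF g]) auto
  hence "\<bar>t * birkhoff_sum g n x - t * birkhoff_sum g n y\<bar> \<le> \<bar>t\<bar> * U k"
    by (simp add: abs_mult[symmetric] right_diff_distrib)
  ultimately show "\<bar>birkhoff_sum f n x + t * birkhoff_sum g n x
      - (birkhoff_sum f n y + t * birkhoff_sum g n y)\<bar> \<le> T k + \<bar>t\<bar> * U k"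
    by linarith
qed

lemma distortion_bound_minus:
  "distortion_bound E f T \<Longrightarrow> distortion_bound E (\<lambda>x. - f x) T"
  unfolding distortion_bound_def birkhoff_sum_minus by (simp add: abs_minus_commute)

lemma distortion_bound_diff_const:
  "distortion_bound E f T \<Longrightarrow> distortion_bound E (\<lambda>x. f x - c) T"
  unfolding distortion_bound_def birkhoff_sum_diff_const by simp

text \<open>\<open>T k\<close> is the tail of the series of variations from its \<open>k\<close>-th
  term, so it tends to 0.\<close>

lemma summable_variations_distortion_bound:
  assumes "summable_variations E f"
  obtains T where "distortion_bound E f T" "T \<longlonglongrightarrow> 0"
proof -
  define v where "v n = osc E f (n + 2)" for n
  show ?thesis
  \<comment> \<open>Over an empty space the supremum in \<open>osc\<close> is minus infinity; a
    point is needed to make the variations nonnegative.\<close>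
  proof (cases "shift_space E = {}")
    case True
    thus ?thesis
      by (intro that[of "\<lambda>_. 0"]) (auto simp: distortion_bound_def)
  next
    case False
    then obtain x0 where x0: "x0 \<in> shift_space E" by blast
    have nonneg: "0 \<le> v n" for n
      unfolding v_def osc_def by (rule SUP_upper2[of "(x0, x0)"]) (use x0 in auto)
    have sum: "(\<Sum>n. v n) < \<infinity>"
      using assms by (simp add: summable_variations_def v_def)
    have fin: "v n \<noteq> \<infinity>" for n
      using suminf_PInfty[of v n, OF nonneg] sum by auto
    define w where "w n = real_of_ereal (v n)" for n
    have vw: "v n = ereal (w n)" for n
      using nonneg[of n] fin[of n] by (cases "v n") (auto simp: w_def)
    have w0: "0 \<le> w n" for n
      using nonneg[of n] by (simp add: vw)
    have "summable w"
      using summable_ereal[of w] w0 sum by (auto simp: vw)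
    have osc: "\<bar>f x - f y\<bar> \<le> w n"
      if "x \<in> shift_space E" "y \<in> shift_space E" "\<And>i. i < n + 2 \<Longrightarrow> x i = y i" for x y n
    proof -
      have "ereal \<bar>f x - f y\<bar> \<le> v n"
        unfolding v_def osc_def by (rule SUP_upper2[of "(x, y)"]) (use that in auto)
      thus ?thesis by (simp add: vw)
    qed
    define T where "T k = (\<Sum>i. w (i + k))" for k
    have "distortion_bound E f T"
      unfolding distortion_bound_def
    proof (intro allI ballI impI)
      fix n k x y
      assume xy: "x \<in> shift_space E" "y \<in> shift_space E" "\<forall>i<n + Suc k. x i = y i"
      have "\<bar>birkhoff_sum f n x - birkhoff_sum f n y\<bar>
          \<le> (\<Sum>i<n. \<bar>f ((shift ^^ i) x) - f ((shift ^^ i) y)\<bar>)"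
        unfolding birkhoff_sum_def sum_subtractf[symmetric] by (rule sum_abs)
      \<comment> \<open>After \<open>i\<close> shifts the points still share
        \<open>(n - Suc i) + k + 2\<close> symbols. Read backwards, these are the terms
        \<open>k\<close> to \<open>k + n - 1\<close> of a convergent series, bounded independently
        of \<open>n\<close>.\<close>
      also have "\<dots> \<le> (\<Sum>i<n. w ((n - Suc i) + k))"
      proof (rule sum_mono)
        fix i assume i: "i \<in> {..<n}"
        show "\<bar>f ((shift ^^ i) x) - f ((shift ^^ i) y)\<bar> \<le> w ((n - Suc i) + k)"
          using xy i by (intro osc funpow_shift_in_shift_space) (auto simp: funpow_shift)
      qed
      also have "\<dots> = (\<Sum>i<n. w (i + k))"
        by (rule sum.nat_diff_reindex)
      also have "\<dots> \<le> T k"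
        unfolding T_def using w0 \<open>summable w\<close>
        by (intro sum_le_suminf) (auto simp: summable_iff_shift)
      finally show "\<bar>birkhoff_sum f n x - birkhoff_sum f n y\<bar> \<le> T k" .
    qed
    moreover have "T \<longlonglongrightarrow> 0"
    proof (rule LIMSEQ_I)
      fix r :: real assume "r > 0"
      show "\<exists>no. \<forall>n\<ge>no. norm (T n - 0) < r"
        using suminf_exist_split[OF \<open>r > 0\<close> \<open>summable w\<close>] by (simp add: T_def)
    qed
    ultimately show ?thesis by (rule that)
  qed
qed

lemma birkhoff_sum_glue:
  assumes f: "distortion_bound E f T" and x: "x \<in> shift_space E" and y: "y \<in> shift_space E"
    and xy: "x n = y 0"
  shows "\<bar>birkhoff_sum f (n + m) (glue n x y) - (birkhoff_sum f n x + birkhoff_sum f m y)\<bar> \<le> T 0"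
proof -
  have "\<bar>birkhoff_sum f n (glue n x y) - birkhoff_sum f n x\<bar> \<le> T 0"
    using x y xy by (intro distortion_boundD[OF f]) (auto intro: glue_in_shift_space glue_agree_Suc)
  thus ?thesis by (simp add: birkhoff_sum_add)
qed

lemma birkhoff_sum_periodize:
  assumes f: "distortion_bound E f T" and x: "x \<in> shift_space E" and "n > 0" "x n = x 0"
  shows "\<bar>birkhoff_sum f n (periodize n x) - birkhoff_sum f n x\<bar> \<le> T 0"
proof (rule distortion_boundD[OF f _ x])
  show "periodize n x \<in> shift_space E"
    using assms shift_space_edge[OF x] by (intro periodize_in_shift_space) 
  show "periodize n x i = x i" if "i < n + Suc 0" for i
    using assms that by (intro periodize_agree_Suc)
qed

section \<open>Connecting states\<close>

lemma path_in_shift_space: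
  assumes "f 0 = a" "f n = b" "\<And>i. i < n \<Longrightarrow> E (f i) (f (Suc i))"
    "y \<in> shift_space E" "y 0 = b"
  shows "glue n f y \<in> shift_space E"
  unfolding shift_space_def
proof (intro CollectI allI)
  fix i
  consider "Suc i < n" | "Suc i = n" | "i \<ge> n" by linarith
  thus "E (glue n f y i) (glue n f y (Suc i))"
  proof cases
    case 2
    thus ?thesis using assms(3)[of i] assms by (auto simp: glue_def)
  qed (use assms in \<open>auto simp: glue_def Suc_diff_le shift_space_edge\<close>)
qed

lemma loops_nonempty_iff:
  assumes "n > 0"
  shows "loops E a n \<noteq> {} \<longleftrightarrow> (E ^^ n) a a"
proof
  assume "loops E a n \<noteq> {}"
  then obtain x where "x \<in> loops E a n" by blast
  from loopsD[OF this] show "(E ^^ n) a a"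
    unfolding relpowp_fun_conv by (intro exI[of _ x]) (auto simp: shift_space_edge)
next
  assume "(E ^^ n) a a"
  then obtain f where f: "f 0 = a" "f n = a" "\<And>i. i < n \<Longrightarrow> E (f i) (f (Suc i))"
    unfolding relpowp_fun_conv by blast
  have "periodize n f \<in> shift_space E"
    using f assms by (intro periodize_in_shift_space) auto
  hence "periodize n f \<in> loops E a n"
    using f by (auto simp: loops_def funpow_shift periodize_def)
  thus "loops E a n \<noteq> {}" by blast
qed

lemma mixing_graph_connect:
  assumes "mixing_graph E"
  obtains x n where "x \<in> shift_space E" "n > 0" "x 0 = b" "x n = c"
proof -
  have conn: "E\<^sup>+\<^sup>+ u v" for u v
    using assms by (simp add: mixing_graph_def)
  obtain m where m: "m > 0" "(E ^^ m) c c"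
    using conn[of c c] by (auto simp: tranclp_power)
  then obtain y where y: "y \<in> shift_space E" "y 0 = c"
    using loops_nonempty_iff[of m E c] loopsD by fast
  obtain n where n: "n > 0" "(E ^^ n) b c"
    using conn[of b c] by (auto simp: tranclp_power)
  then obtain f where f: "f 0 = b" "f n = c" "\<And>i. i < n \<Longrightarrow> E (f i) (f (Suc i))"
    unfolding relpowp_fun_conv by blast
  show ?thesis
  proof (rule that[of "glue n f y" n])
    show "glue n f y \<in> shift_space E"
      by (rule path_in_shift_space[OF f y])
    show "glue n f y n = c" using y by (simp add: glue_def)
  qed (use n f in \<open>auto simp: glue_def\<close>)
qed

text \<open>The aperiodicity condition concerns loops at all states together, and has to be
  transported to the single state \<open>a\<close>.\<close>

lemma mixing_graph_loops_nonempty: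
  assumes mix: "mixing_graph E"
  obtains N where "N > 0" "\<And>n. n \<ge> N \<Longrightarrow> loops E a n \<noteq> {}"
proof -
  define L where "L = {n. n > 0 \<and> (E ^^ n) a a}"
  have "Gcd L = 1"
  proof -
    have "Gcd L dvd n" if n: "n > 0" "(E ^^ n) b b" for n b
    proof -
      obtain k where k: "k > 0" "(E ^^ k) a b"
        using mix by (auto simp: mixing_graph_def tranclp_power)
      obtain l where l: "l > 0" "(E ^^ l) b a"
        using mix by (auto simp: mixing_graph_def tranclp_power)
      \<comment> \<open>The same round trip from \<open>a\<close> through \<open>b\<close>, without
        and with the loop of length \<open>n\<close> at \<open>b\<close>: the difference of the two
        lengths is \<open>n\<close>.\<close>
      have "k + l \<in> L" "k + (n + l) \<in> L"
        unfolding L_def using k l n by (auto simp: relpowp_add)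
      hence "Gcd L dvd k + l" "Gcd L dvd (k + l) + n"
        by (auto intro!: Gcd_dvd simp: add_ac)
      thus ?thesis by (simp add: dvd_add_right_iff)
    qed
    hence "Gcd L dvd Gcd {n. n > 0 \<and> (\<exists>a. (E ^^ n) a a)}"
      by (intro Gcd_greatest) auto
    thus ?thesis using mix by (simp add: mixing_graph_def)
  qed
  moreover have "m + n \<in> L" if "m \<in> L" "n \<in> L" for m n
    using that by (auto simp: L_def relpowp_add)
  ultimately obtain N where N: "\<And>n. n \<ge> N \<Longrightarrow> n \<in> L"
    using eventually_in_numerical_semigroup[of L] by blast
  show ?thesis
  proof (rule that[of "Suc N"])
    fix n assume "n \<ge> Suc N"
    thus "loops E a n \<noteq> {}"
      using N[of n] loops_nonempty_iff[of n E a] by (simp add: L_def)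
  qed simp
qed

section \<open>Gurevich pressure\<close>

text \<open>Real-valued form of the partition sum. Over an infinite set of loops it would take the
  default value 0, hence the finiteness assumption in the comparison with
  \<open>partition_fn\<close>.\<close>

definition loop_sum :: "('a \<Rightarrow> 'a \<Rightarrow> bool) \<Rightarrow> ((nat \<Rightarrow> 'a) \<Rightarrow> real) \<Rightarrow> 'a \<Rightarrow> nat \<Rightarrow> real" where
  "loop_sum E f a n = (\<Sum>x\<in>loops E a n. exp (birkhoff_sum f n x))"

lemma partition_fn_eq_loop_sum:
  assumes "finite (loops E a n)"
  shows "partition_fn E f a n = ennreal (loop_sum E f a n)"
  using assms unfolding partition_fn_def loop_sum_def loops_def
  by (simp add: nn_integral_count_space_finite)

lemma loop_sum_pos:
  assumes "finite (loops E a n)" "loops E a n \<noteq> {}"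
  shows "0 < loop_sum E f a n"
  unfolding loop_sum_def using assms by (intro sum_pos) auto

text \<open>Pairs of loops inject into the longer loops by concatenation. Gluing costs
  \<open>T 0\<close> and closing up costs another \<open>T 0\<close>.\<close>

lemma ln_loop_sum_superadditive:
  assumes f: "distortion_bound E f T" and nm: "n > 0" "m > 0"
    and fin: "\<And>k. k > 0 \<Longrightarrow> finite (loops E a k)"
    and ne: "loops E a n \<noteq> {}" "loops E a m \<noteq> {}"
  shows "ln (loop_sum E f a n) + ln (loop_sum E f a m) - 2 * T 0 \<le> ln (loop_sum E f a (n + m))"
proof -
  let ?F = "\<lambda>(x, y). periodize (n + m) (glue n x y)"
  let ?L = "loops E a n \<times> loops E a m"
  have "loop_sum E f a n * loop_sum E f a m
      = (\<Sum>(x, y)\<in>?L. exp (birkhoff_sum f n x) * exp (birkhoff_sum f m y))"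
    by (simp add: loop_sum_def sum_product sum.cartesian_product)
  hence "exp (- (2 * T 0)) * (loop_sum E f a n * loop_sum E f a m)
      = (\<Sum>(x, y)\<in>?L. exp (birkhoff_sum f n x + birkhoff_sum f m y - 2 * T 0))"
    by (auto simp: sum_distrib_left exp_add exp_diff exp_minus field_simps intro!: sum.cong)
  also have "\<dots> \<le> (\<Sum>z\<in>?L. exp (birkhoff_sum f (n + m) (?F z)))"
  proof (rule sum_mono)
    fix z assume "z \<in> ?L"
    then obtain x y where z: "z = (x, y)" and xy: "x \<in> loops E a n" "y \<in> loops E a m"
      by auto
    note x = loopsD[OF xy(1)] and y = loopsD[OF xy(2)]
    have eq: "x n = y 0" using x(4) y(3) by simp
    have "\<bar>birkhoff_sum f (n + m) (glue n x y) - (birkhoff_sum f n x + birkhoff_sum f m y)\<bar> \<le> T 0"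
      using f x(1) y(1) eq by (rule birkhoff_sum_glue)
    moreover have "\<bar>birkhoff_sum f (n + m) (periodize (n + m) (glue n x y))
        - birkhoff_sum f (n + m) (glue n x y)\<bar> \<le> T 0"
      using nm x(3) y(4) by (intro birkhoff_sum_periodize[OF f] glue_in_shift_space[OF x(1) y(1) eq])
        (simp_all add: glue_0[of x n y, OF eq])
    ultimately show "(case z of (x, y) \<Rightarrow> exp (birkhoff_sum f n x + birkhoff_sum f m y - 2 * T 0))
        \<le> exp (birkhoff_sum f (n + m) (?F z))"
      by (simp add: z)
  qed
  also have "\<dots> = (\<Sum>z\<in>?F ` ?L. exp (birkhoff_sum f (n + m) z))"
    using inj_on_periodize_glue[OF nm] by (subst sum.reindex) auto
  also have "\<dots> \<le> loop_sum E f a (n + m)"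
    unfolding loop_sum_def using nm fin[of "n + m"]
    by (intro sum_mono2) (auto intro: periodize_glue_in_loops)
  finally have le: "exp (- (2 * T 0)) * (loop_sum E f a n * loop_sum E f a m)
      \<le> loop_sum E f a (n + m)" .
  have pos: "loop_sum E f a n > 0" "loop_sum E f a m > 0"
    using loop_sum_pos[OF fin[OF nm(1)] ne(1)] loop_sum_pos[OF fin[OF nm(2)] ne(2)] .
  hence "ln (exp (- (2 * T 0)) * (loop_sum E f a n * loop_sum E f a m))
      \<le> ln (loop_sum E f a (n + m))"
    using le by (intro ln_mono) (auto intro: less_le_trans[OF _ le])
  thus ?thesis using pos by (simp add: ln_mult)
qed

text \<open>Subtracting \<open>2 * T 0\<close> once from each logarithm makes the sequence exactly
  superadditive from \<open>N\<close> on. The limit is then a supremum, so every single length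
  already gives a lower bound for the pressure.\<close>

lemma gurevich_pressure_limit:
  assumes f: "distortion_bound E f T"
    and fin: "\<And>k. k > 0 \<Longrightarrow> finite (loops E a k)"
    and N: "N > 0" "\<And>n. n \<ge> N \<Longrightarrow> loops E a n \<noteq> {}"
  shows "(\<lambda>n. ereal (ln (loop_sum E f a n) / real n)) \<longlonglongrightarrow> gurevich_pressure E f a"
    and "n \<ge> N \<Longrightarrow> ereal ((ln (loop_sum E f a n) - 2 * T 0) / real n) \<le> gurevich_pressure E f a"
proof -
  define u where "u n = ln (loop_sum E f a n) - 2 * T 0" for n
  let ?s = "SUP n\<in>{N..}. ereal (u n / real n)"
  have "u n + u m \<le> u (n + m)" if "n \<ge> N" "m \<ge> N" for n m
    using ln_loop_sum_superadditive[OF f, of n m a] fin N that by (simp add: u_def)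
  hence lim_u: "(\<lambda>n. ereal (u n / real n)) \<longlonglongrightarrow> ?s"
    by (rule superadditive_limit[OF N(1)])
  have "(\<lambda>n. ereal (2 * T 0 / real n)) \<longlonglongrightarrow> ereal 0"
    by (intro tendsto_ereal tendsto_divide_0[OF tendsto_const] filterlim_at_top_imp_at_infinity
        filterlim_real_sequentially)
  hence "(\<lambda>n. ereal (u n / real n) + ereal (2 * T 0 / real n)) \<longlonglongrightarrow> ?s + ereal 0"
    using lim_u by (intro tendsto_add_ereal_general1) auto
  hence lim: "(\<lambda>n. ereal (ln (loop_sum E f a n) / real n)) \<longlonglongrightarrow> ?s"
    by (simp add: u_def diff_divide_distrib zero_ereal_def[symmetric])
  have "eventually (\<lambda>n. ereal (ln (loop_sum E f a n) / real n)
      = ereal (1 / real n) * ln_ennreal (partition_fn E f a n)) sequentially"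
    using eventually_ge_at_top[of N]
  proof eventually_elim
    case (elim n)
    hence "finite (loops E a n)" "loop_sum E f a n > 0"
      using fin N by (auto intro!: loop_sum_pos)
    thus ?case by (simp add: partition_fn_eq_loop_sum ln_ennreal_def)
  qed
  hence "(\<lambda>n. ereal (1 / real n) * ln_ennreal (partition_fn E f a n)) \<longlonglongrightarrow> ?s"
    using lim by (rule Lim_transform_eventually[rotated])
  hence eq: "gurevich_pressure E f a = ?s"
    unfolding gurevich_pressure_def by (rule limI)
  show "(\<lambda>n. ereal (ln (loop_sum E f a n) / real n)) \<longlonglongrightarrow> gurevich_pressure E f a"
    using lim eq by simp
  show "ereal ((ln (loop_sum E f a n) - 2 * T 0) / real n) \<le> gurevich_pressure E f a" if "n \<ge> N"
    unfolding eq u_def[symmetric] using that by (intro SUP_upper) auto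
qed

text \<open>Infinitely many loops of one length, each followed by a fixed loop, give infinitely many
  of every sufficiently large length; all later partition sums of the zero potential would be
  infinite.\<close>

lemma finite_loops:
  assumes mix: "mixing_graph E" and fin_ent: "gurevich_pressure E (\<lambda>_. 0) a < \<infinity>" and "n > 0"
  shows "finite (loops E a n)"
proof (rule ccontr)
  assume inf: "infinite (loops E a n)"
  obtain N where N: "N > 0" "\<And>n. n \<ge> N \<Longrightarrow> loops E a n \<noteq> {}"
    using mixing_graph_loops_nonempty[OF mix] by blast
  have inf': "infinite (loops E a m)" if m: "m \<ge> N + n" for m
  proof
    assume fin: "finite (loops E a m)"
    obtain y where y: "y \<in> loops E a (m - n)"
      using N(2)[of "m - n"] m by fastforce
    let ?F = "\<lambda>(x, y). periodize (n + (m - n)) (glue n x y)"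
    have "inj_on ?F (loops E a n \<times> {y})"
      using assms m N y by (intro inj_on_subset[OF inj_on_periodize_glue[of n "m - n" E a]]) auto
    moreover have "?F ` (loops E a n \<times> {y}) \<subseteq> loops E a m"
      using periodize_glue_in_loops[OF _ y, of _ n] assms m N by auto
    ultimately have "finite (loops E a n \<times> {y})"
      using fin by (metis finite_subset finite_imageD)
    thus False using inf by (simp add: finite_cartesian_product_iff)
  qed
  have "eventually (\<lambda>m. \<infinity> = ereal (1 / real m) * ln_ennreal (partition_fn E (\<lambda>_. 0) a m)) sequentially"
    using eventually_ge_at_top[of "N + n"]
  proof eventually_elim
    case (elim m)
    have "partition_fn E (\<lambda>_. 0) a m = \<infinity>"
      unfolding partition_fn_def birkhoff_sum_def using inf'[OF elim] by (simp add: loops_def)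
    thus ?case using elim N by (simp add: ln_ennreal_def)
  qed
  hence "(\<lambda>m. ereal (1 / real m) * ln_ennreal (partition_fn E (\<lambda>_. 0) a m)) \<longlonglongrightarrow> \<infinity>"
    by (rule Lim_transform_eventually[rotated]) simp
  hence "gurevich_pressure E (\<lambda>_. 0) a = \<infinity>"
    unfolding gurevich_pressure_def by (rule limI)
  thus False using fin_ent by simp
qed

locale mixing_shift =
  fixes E :: "'a::countable \<Rightarrow> 'a \<Rightarrow> bool" and a :: 'a
  assumes mix: "mixing_graph E" and fin_ent: "gurevich_pressure E (\<lambda>_. 0) a < \<infinity>"
begin

lemma finite_loops_a: "n > 0 \<Longrightarrow> finite (loops E a n)"
  using finite_loops[OF mix fin_ent] .

text \<open>There are at most \<open>exp (n * h)\<close> loops of large length \<open>n\<close>,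
  where \<open>h\<close> is the entropy, and each contributes at most \<open>exp (n * C)\<close>; so
  the pressure is at most \<open>C + h\<close>. A single length \<open>N\<close> keeps it above
  minus infinity.\<close>

lemma gurevich_pressure_real:
  assumes f: "distortion_bound E f T" and bdd: "\<And>x. x \<in> shift_space E \<Longrightarrow> f x \<le> C"
  obtains P where "gurevich_pressure E f a = ereal P"
    "(\<lambda>n. ln (loop_sum E f a n) / real n) \<longlonglongrightarrow> P"
proof -
  obtain N where N: "N > 0" "\<And>n. n \<ge> N \<Longrightarrow> loops E a n \<noteq> {}"
    using mixing_graph_loops_nonempty[OF mix] by blast
  \<comment> \<open>The zero potential has no distortion, so the bound on the number of loops
    carries no error term.\<close>
  have "distortion_bound E (\<lambda>_. 0) (\<lambda>_. 0)"
    by (simp add: distortion_bound_def birkhoff_sum_def)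
  from gurevich_pressure_limit(2)[OF this, of a N] finite_loops_a N
  have zero: "ereal (ln (loop_sum E (\<lambda>_. 0) a n) / real n) \<le> gurevich_pressure E (\<lambda>_. 0) a"
    if "n \<ge> N" for n
    using that by simp
  have lim: "(\<lambda>n. ereal (ln (loop_sum E f a n) / real n)) \<longlonglongrightarrow> gurevich_pressure E f a"
    using f finite_loops_a N by (rule gurevich_pressure_limit)
  have lower: "ereal ((ln (loop_sum E f a N) - 2 * T 0) / real N) \<le> gurevich_pressure E f a"
    using f finite_loops_a N order_refl by (rule gurevich_pressure_limit)
  obtain h where h: "gurevich_pressure E (\<lambda>_. 0) a = ereal h"
    using zero[of N] fin_ent by (cases "gurevich_pressure E (\<lambda>_. 0) a") auto
  have "ln (loop_sum E f a n) / real n \<le> C + h" if n: "n \<ge> N" for n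
  proof -
    have "n > 0" using n N by simp
    have pos: "loop_sum E g a n > 0" for g
      using finite_loops_a N n by (intro loop_sum_pos) auto
    have "loop_sum E f a n \<le> (\<Sum>x\<in>loops E a n. exp (real n * C))"
      unfolding loop_sum_def
      using birkhoff_sum_le[OF _ bdd] by (intro sum_mono) (auto simp: loops_def)
    also have "\<dots> = exp (real n * C) * loop_sum E (\<lambda>_. 0) a n"
      by (simp add: loop_sum_def birkhoff_sum_def)
    finally have "ln (loop_sum E f a n) \<le> ln (exp (real n * C) * loop_sum E (\<lambda>_. 0) a n)"
      using pos[of f] by (intro ln_mono) auto
    also have "\<dots> = real n * C + ln (loop_sum E (\<lambda>_. 0) a n)"
      using pos[of "\<lambda>_. 0"] by (simp add: ln_mult)
    also have "ln (loop_sum E (\<lambda>_. 0) a n) \<le> real n * h"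
      using zero[OF n] \<open>n > 0\<close> unfolding h by (simp add: field_simps)
    finally show ?thesis using \<open>n > 0\<close> by (simp add: field_simps)
  qed
  hence "gurevich_pressure E f a \<le> ereal (C + h)"
    by (intro Lim_bounded[OF lim]) auto
  moreover have "gurevich_pressure E f a \<noteq> - \<infinity>"
    using lower by auto
  ultimately obtain P where P: "gurevich_pressure E f a = ereal P"
    by (cases "gurevich_pressure E f a") auto
  show ?thesis
    using that[OF P] lim unfolding P by simp
qed

end

text \<open>Explicit bounds stand in for the regularity assumptions, so that \<open>\<psi>\<close>
  can be replaced by its negative with unchanged constants and every result be used a second
  time.\<close>

locale pressure_family = mixing_shift E a for E :: "'a::countable \<Rightarrow> 'a \<Rightarrow> bool" and a +
  fixes \<phi> \<psi> :: "(nat \<Rightarrow> 'a) \<Rightarrow> real" and T U :: "nat \<Rightarrow> real" and C D :: real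
  assumes phi: "distortion_bound E \<phi> T" and psi: "distortion_bound E \<psi> U" "U \<longlonglongrightarrow> 0"
    and phi_le: "\<And>x. x \<in> shift_space E \<Longrightarrow> \<phi> x \<le> C"
    and psi_le: "\<And>x. x \<in> shift_space E \<Longrightarrow> \<bar>\<psi> x\<bar> \<le> D"
begin

definition pressure :: "real \<Rightarrow> real" where
  "pressure t = real_of_ereal (gurevich_pressure E (\<lambda>x. \<phi> x + t * \<psi> x) a)"

lemma pressure_limit:
  shows "gurevich_pressure E (\<lambda>x. \<phi> x + t * \<psi> x) a = ereal (pressure t)"
    and "(\<lambda>n. ln (loop_sum E (\<lambda>x. \<phi> x + t * \<psi> x) a n) / real n) \<longlonglongrightarrow> pressure t"
proof -
  have "\<phi> x + t * \<psi> x \<le> C + \<bar>t\<bar> * D" if "x \<in> shift_space E" for x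
  proof -
    have "t * \<psi> x \<le> \<bar>t\<bar> * \<bar>\<psi> x\<bar>" by (simp add: abs_mult[symmetric])
    also have "\<dots> \<le> \<bar>t\<bar> * D" using psi_le[OF that] by (rule mult_left_mono) simp
    finally show ?thesis using phi_le[OF that] by simp
  qed
  then obtain P where "gurevich_pressure E (\<lambda>x. \<phi> x + t * \<psi> x) a = ereal P"
    "(\<lambda>n. ln (loop_sum E (\<lambda>x. \<phi> x + t * \<psi> x) a n) / real n) \<longlonglongrightarrow> P"
    using gurevich_pressure_real[OF distortion_bound_linear[OF phi psi(1)]] by blast
  thus "gurevich_pressure E (\<lambda>x. \<phi> x + t * \<psi> x) a = ereal (pressure t)"
    "(\<lambda>n. ln (loop_sum E (\<lambda>x. \<phi> x + t * \<psi> x) a n) / real n) \<longlonglongrightarrow> pressure t"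
    by (simp_all add: pressure_def)
qed

lemma eventually_loops: "eventually (\<lambda>n. n > 0 \<and> finite (loops E a n) \<and> loops E a n \<noteq> {}) sequentially"
proof -
  obtain N where N: "N > 0" "\<And>n. n \<ge> N \<Longrightarrow> loops E a n \<noteq> {}"
    using mixing_graph_loops_nonempty[OF mix] by blast
  thus ?thesis
    using finite_loops_a by (intro eventually_sequentiallyI[of N]) auto
qed

lemma convex_pressure: "convex_on UNIV pressure"
  unfolding convex_on_def
proof (intro conjI ballI allI impI)
  fix s t u v :: real assume uv: "0 \<le> u" "0 \<le> v" "u + v = 1"
  let ?Z = "\<lambda>t n. ln (loop_sum E (\<lambda>x. \<phi> x + t * \<psi> x) a n)"
  have "pressure (u * s + v * t) \<le> u * pressure s + v * pressure t"
  proof (rule tendsto_le[OF trivial_limit_sequentially])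
    show "(\<lambda>n. u * (?Z s n / real n) + v * (?Z t n / real n))
        \<longlonglongrightarrow> u * pressure s + v * pressure t"
      by (intro tendsto_intros pressure_limit)
    show "(\<lambda>n. ?Z (u * s + v * t) n / real n) \<longlonglongrightarrow> pressure (u * s + v * t)"
      by (rule pressure_limit)
    show "eventually (\<lambda>n. ?Z (u * s + v * t) n / real n
        \<le> u * (?Z s n / real n) + v * (?Z t n / real n)) sequentially"
      using eventually_loops
    proof eventually_elim
      case (elim n)
      have combine: "birkhoff_sum \<phi> n x + (u * s + v * t) * birkhoff_sum \<psi> n x
          = u * (birkhoff_sum \<phi> n x + s * birkhoff_sum \<psi> n x)
            + v * (birkhoff_sum \<phi> n x + t * birkhoff_sum \<psi> n x)" for x
      proof -
        have "birkhoff_sum \<phi> n x = (u + v) * birkhoff_sum \<phi> n x" using uv by simp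
        thus ?thesis by (simp add: algebra_simps)
      qed
      have "?Z (u * s + v * t) n \<le> u * ?Z s n + v * ?Z t n"
        unfolding loop_sum_def birkhoff_sum_linear combine
        using elim uv by (intro sum_exp_convex_combination_le) auto
      hence "?Z (u * s + v * t) n / real n \<le> (u * ?Z s n + v * ?Z t n) / real n"
        by (rule divide_right_mono) simp
      thus ?case by (simp add: add_divide_distrib)
    qed
  qed
  thus "pressure (u *\<^sub>R s + v *\<^sub>R t) \<le> u * pressure s + v * pressure t" by simp
qed simp

text \<open>Each weight \<open>exp (t * birkhoff_sum \<psi> n x)\<close> is at most
  \<open>exp (n * \<beta> * t)\<close> and can be pulled out of the sum, which leaves the partition
  sum at parameter 0.\<close>

lemma pressure_le:
  assumes \<beta>: "\<And>n x. n > 0 \<Longrightarrow> x \<in> loops E a n \<Longrightarrow> birkhoff_sum \<psi> n x \<le> real n * \<beta>" and "t \<ge> 0"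
  shows "pressure t \<le> pressure 0 + \<beta> * t"
proof (rule tendsto_le[OF trivial_limit_sequentially])
  let ?Z = "\<lambda>t n. loop_sum E (\<lambda>x. \<phi> x + t * \<psi> x) a n"
  show "(\<lambda>n. ln (?Z 0 n) / real n + \<beta> * t) \<longlonglongrightarrow> pressure 0 + \<beta> * t"
    by (intro tendsto_intros pressure_limit)
  show "(\<lambda>n. ln (?Z t n) / real n) \<longlonglongrightarrow> pressure t"
    by (rule pressure_limit)
  show "eventually (\<lambda>n. ln (?Z t n) / real n \<le> ln (?Z 0 n) / real n + \<beta> * t) sequentially"
    using eventually_loops
  proof eventually_elim
    case (elim n)
    have pos: "?Z s n > 0" for s
      using elim by (intro loop_sum_pos) auto
    have "?Z t n \<le> (\<Sum>x\<in>loops E a n. exp (real n * \<beta> * t) * exp (birkhoff_sum \<phi> n x))"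
      unfolding loop_sum_def birkhoff_sum_linear exp_add[symmetric]
    proof (rule sum_mono)
      fix x assume "x \<in> loops E a n"
      hence "t * birkhoff_sum \<psi> n x \<le> t * (real n * \<beta>)"
        using \<beta> elim \<open>t \<ge> 0\<close> by (intro mult_left_mono) auto
      thus "exp (birkhoff_sum \<phi> n x + t * birkhoff_sum \<psi> n x)
          \<le> exp (real n * \<beta> * t + birkhoff_sum \<phi> n x)"
        by (simp add: algebra_simps)
    qed
    also have "\<dots> = exp (real n * \<beta> * t) * ?Z 0 n"
      by (simp add: loop_sum_def sum_distrib_left)
    finally have "ln (?Z t n) \<le> ln (exp (real n * \<beta> * t) * ?Z 0 n)"
      using pos[of t] by (intro ln_mono) auto
    also have "\<dots> = real n * \<beta> * t + ln (?Z 0 n)"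
      using pos[of 0] by (simp add: ln_mult)
    finally show ?case using elim by (simp add: field_simps)
  qed
qed

text \<open>Running \<open>Suc k\<close> times around the given loop is one term of the partition
  sum of length \<open>Suc k * n\<close>. Its normalised logarithm does not depend on
  \<open>k\<close>, so it survives in the limit along this subsequence.\<close>

lemma pressure_ge:
  assumes "n > 0" "x \<in> loops E a n"
  shows "(birkhoff_sum \<phi> n x + t * birkhoff_sum \<psi> n x) / real n \<le> pressure t"
proof -
  let ?f = "\<lambda>x. \<phi> x + t * \<psi> x"
  have "strict_mono (\<lambda>k. Suc k * n)"
    using assms by (intro strict_monoI) simp
  hence "(\<lambda>k. ln (loop_sum E ?f a (Suc k * n)) / real (Suc k * n)) \<longlonglongrightarrow> pressure t"
    using LIMSEQ_subseq_LIMSEQ[OF pressure_limit(2)[of t], of "\<lambda>k. Suc k * n"]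
    unfolding o_def by blast
  moreover have "birkhoff_sum ?f n x / real n
      \<le> ln (loop_sum E ?f a (Suc k * n)) / real (Suc k * n)" for k
  proof -
    have per: "(shift ^^ (Suc k * n)) x = x"
      using loopsD(2)[OF assms(2)] by (metis funpow_mod_eq mod_mult_self2_is_0 funpow_0)
    hence x: "x \<in> loops E a (Suc k * n)"
      using assms(2) by (simp add: loops_def)
    have "exp (real (Suc k) * birkhoff_sum ?f n x) = exp (birkhoff_sum ?f (Suc k * n) x)"
      by (simp only: birkhoff_sum_periodic_mult[OF loopsD(2)[OF assms(2)]])
    also have "\<dots> \<le> loop_sum E ?f a (Suc k * n)"
      unfolding loop_sum_def using x assms finite_loops_a[of "Suc k * n"]
      by (intro member_le_sum) auto
    finally have "real (Suc k) * birkhoff_sum ?f n x \<le> ln (loop_sum E ?f a (Suc k * n))"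
      by (metis exp_gt_zero less_le_trans ln_ge_iff)
    hence "real (Suc k) * birkhoff_sum ?f n x / real (Suc k * n)
        \<le> ln (loop_sum E ?f a (Suc k * n)) / real (Suc k * n)"
      by (rule divide_right_mono) simp
    thus ?thesis unfolding of_nat_mult by (subst (asm) mult_divide_mult_cancel_left) auto
  qed
  ultimately have "birkhoff_sum ?f n x / real n \<le> pressure t"
    by (intro LIMSEQ_le_const) auto
  thus ?thesis by (simp add: birkhoff_sum_linear)
qed

end

section \<open>Invariant measures\<close>

lemma space_shift_borel [simp]: "space (shift_borel E) = shift_space E"
  unfolding shift_borel_def by (intro space_measure_of) (auto simp: cylinders_def)

lemma sets_shift_borel: "sets (shift_borel E) = sigma_sets (shift_space E) (cylinders E)"
  unfolding shift_borel_def by (intro sets_measure_of) (auto simp: cylinders_def)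

text \<open>Over a countable alphabet there are only countably many finite words, so an open set is
  a countable union of cylinders.\<close>

lemma shift_borel_openI:
  fixes E :: "'a::countable \<Rightarrow> 'a \<Rightarrow> bool"
  assumes "A \<subseteq> shift_space E"
    and op: "\<And>x. x \<in> A \<Longrightarrow> \<exists>n. \<forall>y\<in>shift_space E. (\<forall>i<n. y i = x i) \<longrightarrow> y \<in> A"
  shows "A \<in> sets (shift_borel E)"
proof -
  define cyl where "cyl l = {x \<in> shift_space E. \<forall>i<length l. x i = l ! i}" for l
  have "A = (\<Union>l\<in>{l. cyl l \<subseteq> A}. cyl l)"
  proof (intro equalityI subsetI)
    fix x assume x: "x \<in> A"
    then obtain n where n: "\<And>y. y \<in> shift_space E \<Longrightarrow> (\<forall>i<n. y i = x i) \<Longrightarrow> y \<in> A"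
      using op[OF x] by blast
    have "x \<in> cyl (map x [0..<n])" using x assms by (auto simp: cyl_def)
    moreover have "cyl (map x [0..<n]) \<subseteq> A" using n by (auto simp: cyl_def)
    ultimately show "x \<in> (\<Union>l\<in>{l. cyl l \<subseteq> A}. cyl l)" by blast
  qed auto
  moreover have "cyl l \<in> sets (shift_borel E)" for l
    unfolding sets_shift_borel cyl_def by (rule sigma_sets.Basic) (auto simp: cylinders_def)
  hence "(\<Union>l\<in>{l. cyl l \<subseteq> A}. cyl l) \<in> sets (shift_borel E)"
    by (intro sets.countable_UN'') auto
  ultimately show ?thesis by simp
qed

lemma measurable_shift:
  fixes E :: "'a::countable \<Rightarrow> 'a \<Rightarrow> bool"
  shows "shift \<in> measurable (shift_borel E) (shift_borel E)"
proof (rule measurable_sigma_sets[OF sets_shift_borel])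
  show "cylinders E \<subseteq> Pow (shift_space E)" by (auto simp: cylinders_def)
  show "shift \<in> space (shift_borel E) \<rightarrow> shift_space E" by (auto intro: shift_in_shift_space)
  fix Y assume "Y \<in> cylinders E"
  then obtain n w where Y: "Y = {x \<in> shift_space E. \<forall>i<n. x i = w i}"
    by (auto simp: cylinders_def)
  show "shift -` Y \<inter> space (shift_borel E) \<in> sets (shift_borel E)"
  proof (rule shift_borel_openI)
    fix x assume "x \<in> shift -` Y \<inter> space (shift_borel E)"
    thus "\<exists>n. \<forall>y\<in>shift_space E. (\<forall>i<n. y i = x i) \<longrightarrow> y \<in> shift -` Y \<inter> space (shift_borel E)"
      by (intro exI[of _ "Suc n"]) (auto simp: Y shift_in_shift_space, auto simp: shift_def)
  qed auto
qed

lemma shift_continuous_measurable: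
  fixes E :: "'a::countable \<Rightarrow> 'a \<Rightarrow> bool"
  assumes "shift_continuous E f"
  shows "f \<in> borel_measurable (shift_borel E)"
proof (rule borel_measurableI)
  fix S :: "real set" assume "open S"
  show "f -` S \<inter> space (shift_borel E) \<in> sets (shift_borel E)"
  proof (rule shift_borel_openI)
    fix x assume "x \<in> f -` S \<inter> space (shift_borel E)"
    hence x: "f x \<in> S" "x \<in> shift_space E" by auto
    obtain e where e: "e > 0" "\<And>z. dist z (f x) < e \<Longrightarrow> z \<in> S"
      using \<open>open S\<close> x(1) unfolding open_dist by blast
    obtain n where n: "\<And>y. y \<in> shift_space E \<Longrightarrow> (\<forall>i<n. y i = x i) \<Longrightarrow> \<bar>f y - f x\<bar> < e"
      using assms x(2) e(1) unfolding shift_continuous_def by meson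
    show "\<exists>n. \<forall>y\<in>shift_space E. (\<forall>i<n. y i = x i) \<longrightarrow> y \<in> f -` S \<inter> space (shift_borel E)"
      using n e(2) by (intro exI[of _ n]) (auto simp: dist_real_def)
  qed auto
qed

lemma distortion_bound_continuous:
  assumes f: "distortion_bound E f T" and "T \<longlonglongrightarrow> 0"
  shows "shift_continuous E f"
  unfolding shift_continuous_def
proof (intro ballI allI impI)
  fix x and e :: real assume x: "x \<in> shift_space E" and "e > 0"
  then obtain k where k: "T k < e"
    using order_tendstoD(2)[OF assms(2)] by (metis eventually_sequentially order_refl)
  have "\<bar>f y - f x\<bar> < e" if "y \<in> shift_space E" "\<forall>i<1 + Suc k. y i = x i" for y
  proof -
    have "\<bar>birkhoff_sum f 1 y - birkhoff_sum f 1 x\<bar> \<le> T k"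
      using that x by (intro distortion_boundD[OF f]) auto
    thus ?thesis using k by simp
  qed
  thus "\<exists>n. \<forall>y\<in>shift_space E. (\<forall>i<n. y i = x i) \<longrightarrow> \<bar>f y - f x\<bar> < e" by blast
qed

lemma invariant_measuresD:
  assumes "\<mu> \<in> invariant_measures E"
  shows "prob_space \<mu>" "sets \<mu> = sets (shift_borel E)" "space \<mu> = shift_space E"
    "shift \<in> measurable \<mu> \<mu>" "distr \<mu> \<mu> shift = \<mu>"
proof -
  show *: "prob_space \<mu>" "sets \<mu> = sets (shift_borel E)" "shift \<in> measurable \<mu> \<mu>"
    using assms by (auto simp: invariant_measures_def)
  show "space \<mu> = shift_space E" using sets_eq_imp_space_eq[OF *(2)] by simp
  show "distr \<mu> \<mu> shift = \<mu>"
    using assms by (intro measure_eqI) (auto simp: emeasure_distr invariant_measures_def)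
qed

lemma integral_birkhoff_sum:
  assumes \<mu>: "\<mu> \<in> invariant_measures E" and f: "f \<in> borel_measurable (shift_borel E)"
    and bdd: "\<And>x. x \<in> shift_space E \<Longrightarrow> \<bar>f x\<bar> \<le> C"
  shows "integrable \<mu> (birkhoff_sum f n)" "integral\<^sup>L \<mu> (birkhoff_sum f n) = real n * integral\<^sup>L \<mu> f"
proof -
  note \<mu> = invariant_measuresD[OF \<mu>]
  interpret prob_space \<mu> by (rule \<mu>)
  have f': "f \<in> borel_measurable \<mu>"
    using f measurable_cong_sets[OF \<mu>(2) refl] by blast
  have pow: "(shift ^^ k) \<in> measurable \<mu> \<mu>" for k
    by (induction k) (auto intro: measurable_comp[OF _ \<mu>(4), unfolded o_def] simp: o_def)
  have int: "integrable \<mu> (\<lambda>x. f ((shift ^^ k) x))" for k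
  proof (rule integrable_const_bound[where B = C])
    show "(\<lambda>x. f ((shift ^^ k) x)) \<in> borel_measurable \<mu>"
      using measurable_comp[OF pow f'] by (simp add: o_def)
    show "AE x in \<mu>. norm (f ((shift ^^ k) x)) \<le> C"
      using bdd funpow_shift_in_shift_space \<mu>(3) by (intro AE_I2) auto
  qed
  have eq: "integral\<^sup>L \<mu> (\<lambda>x. f ((shift ^^ k) x)) = integral\<^sup>L \<mu> f" for k
  proof (induction k)
    case (Suc k)
    have "integral\<^sup>L \<mu> (\<lambda>x. f ((shift ^^ Suc k) x)) = integral\<^sup>L \<mu> (\<lambda>x. f ((shift ^^ k) (shift x)))"
      by (simp add: funpow_swap1)
    also have "\<dots> = integral\<^sup>L (distr \<mu> \<mu> shift) (\<lambda>x. f ((shift ^^ k) x))"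
      using int[of k] by (intro integral_distr[symmetric] \<mu>(4)) auto
    also have "\<dots> = integral\<^sup>L \<mu> f" using Suc \<mu>(5) by simp
    finally show ?case .
  qed simp
  show "integrable \<mu> (birkhoff_sum f n)"
    unfolding birkhoff_sum_def using int by auto
  show "integral\<^sup>L \<mu> (birkhoff_sum f n) = real n * integral\<^sup>L \<mu> f"
    unfolding birkhoff_sum_def using int eq by (simp add: Bochner_Integration.integral_sum)
qed

text \<open>Uniform distribution on the \<open>n\<close> positions of the orbit; points are counted
  with multiplicity if \<open>n\<close> is not the minimal period.\<close>

lemma periodic_invariant_measure:
  fixes E :: "'a::countable \<Rightarrow> 'a \<Rightarrow> bool"
  assumes x: "x \<in> shift_space E" and per: "(shift ^^ n) x = x" and "n > 0"
  obtains \<mu> where "\<mu> \<in> invariant_measures E"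
    "\<And>f. f \<in> borel_measurable (shift_borel E) \<Longrightarrow> integral\<^sup>L \<mu> f = birkhoff_sum f n x / real n"
proof -
  let ?P = "measure_pmf (pmf_of_set {..<n})"
  let ?g = "\<lambda>k. (shift ^^ k) x"
  define \<mu> where "\<mu> = distr ?P (shift_borel E) ?g"
  have ne: "{..<n} \<noteq> {}" using \<open>n > 0\<close> by auto
  have g: "?g \<in> measurable ?P (shift_borel E)"
    using funpow_shift_in_shift_space[OF x] by auto
  have int: "integral\<^sup>L \<mu> f = birkhoff_sum f n x / real n"
    if "f \<in> borel_measurable (shift_borel E)" for f
    unfolding \<mu>_def using integral_distr[OF g that]
    by (simp add: integral_pmf_of_set[OF ne] birkhoff_sum_def)
  interpret prob_space \<mu>
    unfolding \<mu>_def using g by (rule measure_pmf.prob_space_distr)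
  have sh: "shift \<in> measurable \<mu> \<mu>"
    using measurable_shift[of E] by (simp add: \<mu>_def)
  have "emeasure \<mu> (shift -` A \<inter> space \<mu>) = emeasure \<mu> A" if A: "A \<in> sets \<mu>" for A
  proof -
    have A': "A \<in> sets (shift_borel E)" using A by (simp add: \<mu>_def)
    have B: "shift -` A \<inter> space \<mu> \<in> sets \<mu>" using sh A by (rule measurable_sets)
    hence B': "shift -` A \<inter> space \<mu> \<in> sets (shift_borel E)" by (simp add: \<mu>_def)
    have "measure \<mu> (shift -` A \<inter> space \<mu>)
        = birkhoff_sum (indicator (shift -` A \<inter> space \<mu>)) n x / real n"
      using int[of "indicator (shift -` A \<inter> space \<mu>)"] B B'
      by (simp add: emeasure_eq_measure)
    also have "birkhoff_sum (indicator (shift -` A \<inter> space \<mu>)) n x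
        = birkhoff_sum (indicator A) n (shift x)"
      unfolding birkhoff_sum_def using funpow_shift_in_shift_space[OF x]
      by (intro sum.cong) (auto simp: \<mu>_def indicator_def funpow_swap1)
    \<comment> \<open>The sum over \<open>n + 1\<close> times is split at its first and then at its
      last term; periodicity makes these two terms equal.\<close>
    also have "\<dots> = birkhoff_sum (indicator A) (Suc 0 + n) x - indicator A x"
      by (simp add: birkhoff_sum_add del: add_Suc)
    also have "\<dots> = birkhoff_sum (indicator A) n x"
      using birkhoff_sum_add[of "indicator A" n "Suc 0" x] per by (simp add: add.commute)
    also have "birkhoff_sum (indicator A) n x / real n = measure \<mu> A"
      using int[of "indicator A"] A A' by (simp add: emeasure_eq_measure)
    finally show ?thesis by (simp add: emeasure_eq_measure)
  qed
  hence "\<mu> \<in> invariant_measures E"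
    unfolding invariant_measures_def using sh prob_space_axioms by (auto simp: \<mu>_def)
  thus ?thesis using int by (rule that)
qed

section \<open>Integrals are bounded by periodic averages\<close>

text \<open>Intended for \<open>\<psi>\<close> minus a constant, where neither \<open>\<phi>\<close>
  nor entropy is involved.\<close>

locale distorted_potential =
  fixes E :: "'a::countable \<Rightarrow> 'a \<Rightarrow> bool" and g :: "(nat \<Rightarrow> 'a) \<Rightarrow> real"
    and U :: "nat \<Rightarrow> real" and D :: real
  assumes mix: "mixing_graph E" and dist: "distortion_bound E g U" and U0: "U \<longlonglongrightarrow> 0"
    and bdd: "\<And>x. x \<in> shift_space E \<Longrightarrow> \<bar>g x\<bar> \<le> D"
begin

lemma D_nonneg: "D \<ge> 0"
proof -
  obtain x where "x \<in> shift_space E"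
    using mixing_graph_connect[OF mix] by metis
  thus ?thesis using bdd[of x] by simp
qed

lemma g_measurable: "g \<in> borel_measurable (shift_borel E)"
  by (intro shift_continuous_measurable distortion_bound_continuous[OF dist U0])

text \<open>Fixed connections from \<open>a\<close> to \<open>b\<close> and back complete any orbit
  segment from \<open>b\<close> to \<open>b\<close> to a loop at \<open>a\<close>. The cost is two
  gluings, one closing (hence \<open>3 * U 0\<close>) and the sums along the connections; it depends
  on \<open>b\<close> but not on the segment.\<close>

lemma return_bound:
  assumes loops: "\<And>n x. n > 0 \<Longrightarrow> x \<in> loops E a n \<Longrightarrow> birkhoff_sum g n x \<le> 0"
  shows "\<exists>V\<ge>0. \<forall>y\<in>shift_space E. \<forall>n. y 0 = b \<longrightarrow> y n = b \<longrightarrow> birkhoff_sum g n y \<le> V"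
proof -
  obtain u k where u: "u \<in> shift_space E" "k > 0" "u 0 = a" "u k = b"
    using mixing_graph_connect[OF mix] by blast
  obtain v l where v: "v \<in> shift_space E" "l > 0" "v 0 = b" "v l = a"
    using mixing_graph_connect[OF mix] by blast
  have "birkhoff_sum g n y \<le> \<bar>3 * U 0 + real k * D + real l * D\<bar>"
    if y: "y \<in> shift_space E" "y 0 = b" "y n = b" for y n
  proof -
    define w where "w = glue n y v"
    define z where "z = glue k u w"
    have w: "w \<in> shift_space E" "w 0 = b" "w (n + l) = a"
      using y v by (auto simp: w_def glue_in_shift_space glue_0)
    have z: "z \<in> shift_space E" "z 0 = a" "z (k + (n + l)) = a"
      using w u by (simp_all add: z_def glue_in_shift_space glue_0)
    have "\<bar>birkhoff_sum g (n + l) w - (birkhoff_sum g n y + birkhoff_sum g l v)\<bar> \<le> U 0"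
      unfolding w_def using y v by (intro birkhoff_sum_glue[OF dist]) auto
    moreover have "\<bar>birkhoff_sum g (k + (n + l)) z
        - (birkhoff_sum g k u + birkhoff_sum g (n + l) w)\<bar> \<le> U 0"
      unfolding z_def using u w by (intro birkhoff_sum_glue[OF dist]) auto
    moreover have "\<bar>birkhoff_sum g (k + (n + l)) (periodize (k + (n + l)) z)
        - birkhoff_sum g (k + (n + l)) z\<bar> \<le> U 0"
      using z u by (intro birkhoff_sum_periodize[OF dist]) auto
    moreover have "birkhoff_sum g (k + (n + l)) (periodize (k + (n + l)) z) \<le> 0"
      using periodize_in_loops[of "k + (n + l)" z E] z u by (intro loops) auto
    moreover have "\<bar>birkhoff_sum g k u\<bar> \<le> real k * D" "\<bar>birkhoff_sum g l v\<bar> \<le> real l * D"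
      using birkhoff_sum_abs_le[OF _ bdd] u v by auto
    ultimately show ?thesis by linarith
  qed
  thus ?thesis by (intro exI[of _ "\<bar>3 * U 0 + real k * D + real l * D\<bar>"]) auto
qed

text \<open>Its Birkhoff sum counts the time spent outside \<open>F\<close>, and its integral is the
  mass of the points whose initial state lies outside \<open>F\<close>.\<close>

definition outside :: "'a set \<Rightarrow> (nat \<Rightarrow> 'a) \<Rightarrow> real" where
  "outside F x = (if x 0 \<in> F then 0 else 1)"

lemma birkhoff_sum_outside_nonneg: "0 \<le> birkhoff_sum (outside F) n x"
  unfolding birkhoff_sum_def outside_def by (intro sum_nonneg) auto

lemma birkhoff_sum_outside_insert:
  assumes "\<And>i. i < n \<Longrightarrow> x i \<noteq> b"
  shows "birkhoff_sum (outside (insert b F)) n x = birkhoff_sum (outside F) n x"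
  unfolding birkhoff_sum_def outside_def using assms by (intro sum.cong) (auto simp: funpow_shift)

text \<open>Between its first and last visit to a state the orbit makes a loop, which contributes at most
  a constant; removing this segment eliminates one state of the finite set at a time.\<close>

lemma finite_states_bound:
  assumes loops: "\<And>n x. n > 0 \<Longrightarrow> x \<in> loops E a n \<Longrightarrow> birkhoff_sum g n x \<le> 0"
    and "finite F"
  shows "\<exists>K\<ge>0. \<forall>x\<in>shift_space E. \<forall>n. birkhoff_sum g n x \<le> K + D * birkhoff_sum (outside F) n x"
  using assms(2)
proof (induction F)
  case empty
  have "birkhoff_sum g n x \<le> D * birkhoff_sum (outside {}) n x" if "x \<in> shift_space E" for x n
    using birkhoff_sum_abs_le[of x E g D n, OF that bdd] by (simp add: birkhoff_sum_def outside_def mult.commute)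
  thus ?case by (intro exI[of _ 0]) auto
next
  case (insert b F)
  then obtain K where K: "K \<ge> 0"
    "\<And>x n. x \<in> shift_space E \<Longrightarrow> birkhoff_sum g n x \<le> K + D * birkhoff_sum (outside F) n x"
    by blast
  have "\<exists>V\<ge>0. \<forall>y\<in>shift_space E. \<forall>n. y 0 = b \<longrightarrow> y n = b \<longrightarrow> birkhoff_sum g n y \<le> V"
    using loops by (rule return_bound)
  then obtain V where V: "V \<ge> 0"
    "\<And>y n. y \<in> shift_space E \<Longrightarrow> y 0 = b \<Longrightarrow> y n = b \<Longrightarrow> birkhoff_sum g n y \<le> V"
    by blast
  let ?o = "outside (insert b F)"
  have avoid: "birkhoff_sum g n x \<le> K + D * birkhoff_sum ?o n x"
    if "x \<in> shift_space E" "\<And>i. i < n \<Longrightarrow> x i \<noteq> b" for x n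
    using K(2)[OF that(1), of n] birkhoff_sum_outside_insert[of n x b F] that(2) by simp
  \<comment> \<open>One \<open>K\<close> each for the parts before the first and after the last
    visit to \<open>b\<close>, \<open>V\<close> for the part between these visits, and
    \<open>D\<close> for the time of the last visit, which is split off so that the tail avoids
    \<open>b\<close>.\<close>
  have "birkhoff_sum g n x \<le> (2 * K + V + D) + D * birkhoff_sum ?o n x"
    if x: "x \<in> shift_space E" for x n
  proof (cases "\<exists>i<n. x i = b")
    case False
    thus ?thesis using avoid[OF x, of n] K V D_nonneg by auto
  next
    case True
    define i where "i = (LEAST i. x i = b)"
    define j where "j = Max {i. i < n \<and> x i = b}"
    have i: "x i = b" "\<And>k. k < i \<Longrightarrow> x k \<noteq> b"
      unfolding i_def using True by (auto intro: LeastI dest: not_less_Least)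
    have j: "j < n" "x j = b"
      using Max_in[of "{i. i < n \<and> x i = b}"] True unfolding j_def by auto
    have j': "k \<le> j" if "k < n" "x k = b" for k
      unfolding j_def using that by (intro Max_ge) auto
    have "i \<le> j" using i(2)[of j] j by (metis not_less)
    define m where "m = n - Suc j"
    have n: "n = i + ((j - i) + (Suc 0 + m))"
      using \<open>i \<le> j\<close> j by (simp add: m_def)
    have split: "birkhoff_sum f n x = birkhoff_sum f i x + (birkhoff_sum f (j - i) ((shift ^^ i) x)
        + (f ((shift ^^ j) x) + birkhoff_sum f m ((shift ^^ Suc j) x)))" for f
    proof -
      have "(shift ^^ (j - i)) ((shift ^^ i) x) = (shift ^^ j) x"
        using \<open>i \<le> j\<close> by (simp add: funpow_shift add_ac)
      moreover have "(shift ^^ Suc 0) ((shift ^^ j) x) = (shift ^^ Suc j) x" by simp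
      ultimately show ?thesis
        unfolding n birkhoff_sum_add by (simp only: birkhoff_sum_1)
    qed
    have "birkhoff_sum g i x \<le> K + D * birkhoff_sum ?o i x"
      using avoid[OF x] i by blast
    moreover have "birkhoff_sum g (j - i) ((shift ^^ i) x) \<le> V"
      using i j \<open>i \<le> j\<close> by (intro V funpow_shift_in_shift_space x) (auto simp: funpow_shift)
    moreover have "g ((shift ^^ j) x) \<le> D"
      using bdd[OF funpow_shift_in_shift_space[OF x, of j]] by simp
    moreover have "birkhoff_sum g m ((shift ^^ Suc j) x)
        \<le> K + D * birkhoff_sum ?o m ((shift ^^ Suc j) x)"
    proof (rule avoid[OF funpow_shift_in_shift_space[OF x]])
      fix k assume "k < m"
      hence "k + Suc j < n" by (simp add: m_def)
      thus "(shift ^^ Suc j) x k \<noteq> b"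
        using j'[of "k + Suc j"] by (auto simp: funpow_shift simp del: funpow.simps)
    qed
    moreover have "D * birkhoff_sum ?o i x + D * birkhoff_sum ?o m ((shift ^^ Suc j) x)
        \<le> D * birkhoff_sum ?o n x"
    proof -
      have "0 \<le> ?o ((shift ^^ j) x)" by (simp add: outside_def)
      hence "birkhoff_sum ?o i x + birkhoff_sum ?o m ((shift ^^ Suc j) x) \<le> birkhoff_sum ?o n x"
        unfolding split using birkhoff_sum_outside_nonneg[of "insert b F" "j - i" "(shift ^^ i) x"] by linarith
      thus ?thesis using D_nonneg by (metis distrib_left mult_left_mono)
    qed
    ultimately show ?thesis unfolding split[of g] by linarith
  qed
  thus ?case using K V D_nonneg by (intro exI[of _ "2 * K + V + D"]) auto
qed

text \<open>The pointwise bound is integrated by invariance and divided by \<open>n\<close>. As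
  \<open>K\<close> depends on the finite set, \<open>n\<close> tends to infinity before the set
  exhausts all states.\<close>

lemma integral_nonpos:
  assumes loops: "\<And>n x. n > 0 \<Longrightarrow> x \<in> loops E a n \<Longrightarrow> birkhoff_sum g n x \<le> 0"
    and \<mu>: "\<mu> \<in> invariant_measures E"
  shows "integral\<^sup>L \<mu> g \<le> 0"
proof -
  interpret prob_space \<mu> using invariant_measuresD[OF \<mu>] by simp
  define F where "F m = {b::'a. to_nat b < m}" for m
  have F: "finite (F m)" for m
    unfolding F_def using finite_vimageI[of "{..<m}" "to_nat :: 'a \<Rightarrow> nat"] by (simp add: vimage_def)
  have meas: "outside G \<in> borel_measurable (shift_borel E)" for G
  proof (rule shift_continuous_measurable)
    show "shift_continuous E (outside G)"
      unfolding shift_continuous_def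
      by (intro ballI allI impI exI[of _ "Suc 0"]) (auto simp: outside_def)
  qed
  have meas': "outside G \<in> borel_measurable \<mu>" for G
    using meas measurable_cong_sets[OF invariant_measuresD(2)[OF \<mu>] refl] by blast
  have "integral\<^sup>L \<mu> g \<le> D * integral\<^sup>L \<mu> (outside (F m))" for m
  proof -
    have "\<exists>K\<ge>0. \<forall>x\<in>shift_space E. \<forall>n.
        birkhoff_sum g n x \<le> K + D * birkhoff_sum (outside (F m)) n x"
      using loops F by (rule finite_states_bound)
    then obtain K where K: "K \<ge> 0"
      "\<And>x n. x \<in> shift_space E \<Longrightarrow> birkhoff_sum g n x \<le> K + D * birkhoff_sum (outside (F m)) n x"
      by blast
    have bound: "\<bar>outside (F m) x\<bar> \<le> 1" for x by (simp add: outside_def)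
    have int: "integrable \<mu> (birkhoff_sum g n)"
        "integral\<^sup>L \<mu> (birkhoff_sum g n) = real n * integral\<^sup>L \<mu> g" for n
      by (rule integral_birkhoff_sum[OF \<mu> g_measurable], erule bdd)+
    note int' = integral_birkhoff_sum[OF \<mu> meas bound]
    have "integral\<^sup>L \<mu> g \<le> K / real n + D * integral\<^sup>L \<mu> (outside (F m))" if "n > 0" for n
    proof -
      have "real n * integral\<^sup>L \<mu> g = integral\<^sup>L \<mu> (birkhoff_sum g n)" by (rule int(2)[symmetric])
      also have "\<dots> \<le> integral\<^sup>L \<mu> (\<lambda>x. K + D * birkhoff_sum (outside (F m)) n x)"
        using int(1)[of n] int'(1)[of n] K(2) invariant_measuresD(3)[OF \<mu>]
        by (intro integral_mono) auto
      also have "\<dots> = K + D * (real n * integral\<^sup>L \<mu> (outside (F m)))"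
        using int'[of n] by (simp add: prob_space)
      finally show ?thesis using that by (simp add: field_simps)
    qed
    moreover have "(\<lambda>n. K / real n + D * integral\<^sup>L \<mu> (outside (F m)))
        \<longlonglongrightarrow> 0 + D * integral\<^sup>L \<mu> (outside (F m))"
      by (intro tendsto_intros tendsto_divide_0[OF tendsto_const] filterlim_at_top_imp_at_infinity
          filterlim_real_sequentially)
    ultimately show ?thesis
      by (intro LIMSEQ_le_const[where X = "\<lambda>n. K / real n + D * integral\<^sup>L \<mu> (outside (F m))"])
        (auto intro!: exI[of _ 1])
  qed
  moreover have "(\<lambda>m. integral\<^sup>L \<mu> (outside (F m))) \<longlonglongrightarrow> integral\<^sup>L \<mu> (\<lambda>_. 0)"
  proof (rule integral_dominated_convergence[where w = "\<lambda>_. 1"])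
    show "AE x in \<mu>. (\<lambda>m. outside (F m) x) \<longlonglongrightarrow> 0"
    proof (rule AE_I2)
      fix x :: "nat \<Rightarrow> 'a"
      have "eventually (\<lambda>m. outside (F m) x = 0) sequentially"
        using eventually_gt_at_top[of "to_nat (x 0)"]
        by eventually_elim (auto simp: outside_def F_def)
      thus "(\<lambda>m. outside (F m) x) \<longlonglongrightarrow> 0" by (rule tendsto_eventually)
    qed
  qed (auto simp: meas', auto simp: outside_def)
  hence "(\<lambda>m. D * integral\<^sup>L \<mu> (outside (F m))) \<longlonglongrightarrow> D * 0"
    by (intro tendsto_mult_left) simp
  ultimately show ?thesis
    by (intro LIMSEQ_le_const[where X = "\<lambda>m. D * integral\<^sup>L \<mu> (outside (F m))"]) auto
qed

end

section \<open>A Livsic theorem\<close>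

context distorted_potential
begin

text \<open>The transfer function is minus the supremum of the Birkhoff sums along all orbit segments
  that lead from a fixed state to the point. Vanishing of the periodic sums makes this supremum
  asymptotically independent of the chosen segment.\<close>

lemma coboundary_if_periodic_sums_vanish:
  assumes zero: "\<And>n x. n > 0 \<Longrightarrow> x \<in> shift_space E \<Longrightarrow> (shift ^^ n) x = x \<Longrightarrow> birkhoff_sum g n x = 0"
  shows "\<exists>r. shift_continuous E r \<and> (\<forall>x\<in>shift_space E. g x = r x - r (shift x))"
proof -
  fix a :: 'a
  define G where "G x = {birkhoff_sum g n y | n y. y \<in> shift_space E \<and> y 0 = a \<and> (shift ^^ n) y = x}" for x
  define h where "h x = Sup (G x)" for x
  have ne: "G x \<noteq> {}" if "x \<in> shift_space E" for x
  proof -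
    obtain u k where u: "u \<in> shift_space E" "k > 0" "u 0 = a" "u k = x 0"
      using mixing_graph_connect[OF mix] by blast
    hence "birkhoff_sum g k (glue k u x) \<in> G x"
      unfolding G_def using that
      by (intro CollectI exI[of _ k] exI[of _ "glue k u x"]) (auto simp: glue_in_shift_space glue_0)
    thus ?thesis by blast
  qed
  have bdd_G: "bdd_above (G x)" if "x \<in> shift_space E" for x
  proof -
    obtain v l where v: "v \<in> shift_space E" "l > 0" "v 0 = x 0" "v l = a"
      using mixing_graph_connect[OF mix] by blast
    have "birkhoff_sum g n y \<le> 2 * U 0 + real l * D"
      if y: "y \<in> shift_space E" "y 0 = a" "(shift ^^ n) y = x" for n y
    proof -
      have yn: "y n = v 0" using fun_cong[OF y(3), of 0] v by (simp add: funpow_shift)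
      define z where "z = glue n y v"
      have z: "z \<in> shift_space E" "z 0 = a" "z (n + l) = a"
        using y v yn by (auto simp: z_def glue_in_shift_space glue_0)
      have "\<bar>birkhoff_sum g (n + l) z - (birkhoff_sum g n y + birkhoff_sum g l v)\<bar> \<le> U 0"
        unfolding z_def using y v yn by (intro birkhoff_sum_glue[OF dist]) auto
      moreover have "\<bar>birkhoff_sum g (n + l) (periodize (n + l) z) - birkhoff_sum g (n + l) z\<bar> \<le> U 0"
        using z v by (intro birkhoff_sum_periodize[OF dist]) auto
      moreover have "birkhoff_sum g (n + l) (periodize (n + l) z) = 0"
        using loopsD(1,2)[OF periodize_in_loops[of "n + l" z E]] z v by (intro zero) auto
      moreover have "\<bar>birkhoff_sum g l v\<bar> \<le> real l * D"
        using birkhoff_sum_abs_le[OF _ bdd] v by auto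
      ultimately show ?thesis by linarith
    qed
    thus ?thesis unfolding G_def by (intro bdd_aboveI[of _ "2 * U 0 + real l * D"]) auto
  qed
  have upper: "birkhoff_sum g n y \<le> h x"
    if "y \<in> shift_space E" "y 0 = a" "(shift ^^ n) y = x" for n y x
    unfolding h_def using that funpow_shift_in_shift_space[OF that(1), of n]
    by (intro cSup_upper bdd_G) (auto simp: G_def)
  have least: "h x \<le> M"
    if "x \<in> shift_space E"
      "\<And>n y. y \<in> shift_space E \<Longrightarrow> y 0 = a \<Longrightarrow> (shift ^^ n) y = x \<Longrightarrow> birkhoff_sum g n y \<le> M" for x M
    unfolding h_def using that ne by (intro cSup_least) (auto simp: G_def)
  \<comment> \<open>Every history of \<open>x\<close> can be continued by \<open>x'\<close> instead;
    the longer the common beginning, the smaller the change of the sum. This gives the modulus of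
    continuity.\<close>
  have osc: "h x \<le> h x' + U k"
    if x: "x \<in> shift_space E" "x' \<in> shift_space E" "\<And>i. i < Suc k \<Longrightarrow> x i = x' i" for x x' k
  proof (rule least[OF x(1)])
    fix n y assume y: "y \<in> shift_space E" "y 0 = a" "(shift ^^ n) y = x"
    have yn: "y (n + i) = x i" for i using fun_cong[OF y(3), of i] by (simp add: funpow_shift add.commute)
    have eq: "y n = x' 0" using yn[of 0] x(3)[of 0] by simp
    have z: "glue n y x' \<in> shift_space E" using y x eq by (intro glue_in_shift_space)
    have "\<bar>birkhoff_sum g n (glue n y x') - birkhoff_sum g n y\<bar> \<le> U k"
      using z y x yn by (intro distortion_boundD[OF dist] glue_agree[of "Suc k"]) auto
    moreover have "birkhoff_sum g n (glue n y x') \<le> h x'"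
      using z y eq by (intro upper) (auto simp: glue_0)
    ultimately show "birkhoff_sum g n y \<le> h x' + U k" by linarith
  qed
  have "shift_continuous E (\<lambda>x. - h x)"
    unfolding shift_continuous_def
  proof (intro ballI allI impI)
    fix x and e :: real assume x: "x \<in> shift_space E" and "e > 0"
    then obtain k where k: "U k < e"
      using order_tendstoD(2)[OF U0] by (metis eventually_sequentially order_refl)
    have "\<bar>- h y - - h x\<bar> < e" if "y \<in> shift_space E" "\<forall>i<Suc k. y i = x i" for y
      using osc[of x y k] osc[of y x k] that x k by auto
    thus "\<exists>n. \<forall>y\<in>shift_space E. (\<forall>i<n. y i = x i) \<longrightarrow> \<bar>- h y - - h x\<bar> < e" by blast
  qed
  moreover have "g x = - h x - - h (shift x)" if x: "x \<in> shift_space E" for x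
  proof -
    have sx: "shift x \<in> shift_space E" using x by (rule shift_in_shift_space)
    \<comment> \<open>The easy direction: a history of \<open>x\<close> followed for one more step
      is a history of \<open>shift x\<close>.\<close>
    have "h x \<le> h (shift x) - g x"
    proof (rule least[OF x])
      fix n y assume y: "y \<in> shift_space E" "y 0 = a" "(shift ^^ n) y = x"
      have "birkhoff_sum g (n + Suc 0) y \<le> h (shift x)"
        using y by (intro upper) auto
      thus "birkhoff_sum g n y \<le> h (shift x) - g x"
        using y by (simp only: birkhoff_sum_add birkhoff_sum_1)
    qed
    \<comment> \<open>A history of \<open>shift x\<close> has to become one of \<open>x\<close>,
      although it need not pass through \<open>x\<close>. It is continued along
      \<open>shift x\<close> for \<open>k\<close> steps and then led to \<open>x\<close>. This
      detour \<open>s\<close>, followed by the step from \<open>x\<close> to \<open>shift x\<close>,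
      nearly closes up, so its sum is within \<open>U k\<close> of 0.\<close>
    moreover have "h (shift x) \<le> h x + g x"
    proof (rule least[OF sx])
      fix n y assume y: "y \<in> shift_space E" "y 0 = a" "(shift ^^ n) y = shift x"
      have yn: "y (n + i) = x (Suc i)" for i
        using fun_cong[OF y(3), of i] by (simp add: funpow_shift shift_def add.commute)
      \<comment> \<open>One \<open>U k\<close> comes from changing the future of \<open>y\<close>,
        the other from closing the detour. The connecting path varies with \<open>k\<close>, but its
        length does not enter the bound, so \<open>k\<close> may tend to infinity.\<close>
      have "birkhoff_sum g n y \<le> h x + g x + 2 * U k" for k
      proof -
        obtain c m where c: "c \<in> shift_space E" "m > 0" "c 0 = x (Suc k)" "c m = x 0"
          using mixing_graph_connect[OF mix] by blast
        define s where "s = glue k (shift x) (glue m c x)"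
        define l where "l = k + m"
        have cx: "glue m c x \<in> shift_space E" "glue m c x 0 = x (Suc k)"
          using c x by (auto simp: glue_in_shift_space glue_0)
        have s: "s \<in> shift_space E"
          unfolding s_def using cx(2) by (intro glue_in_shift_space[OF sx cx(1)]) (simp add: shift_def)
        have s_head: "s i = x (Suc i)" if "i < Suc k" for i
          unfolding s_def using that cx(2)
          by (subst glue_agree[of "Suc 0"]) (auto simp: shift_def)
        have s_tail: "(shift ^^ l) s = x"
        proof -
          have "(shift ^^ l) s = (shift ^^ m) ((shift ^^ k) s)"
            by (simp add: l_def funpow_shift add_ac)
          thus ?thesis by (simp add: s_def)
        qed
        define z where "z = glue n y s"
        have yn0: "y n = s 0" using yn[of 0] s_head[of 0] by simp
        have z: "z \<in> shift_space E" "z 0 = a"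
          using y s yn0 by (auto simp: z_def glue_in_shift_space glue_0)
        have z_tail: "(shift ^^ (n + l)) z = x"
        proof -
          have "(shift ^^ (n + l)) z = (shift ^^ l) ((shift ^^ n) z)"
            by (simp add: funpow_shift add_ac)
          thus ?thesis using s_tail by (simp add: z_def)
        qed
        have "\<bar>birkhoff_sum g n z - birkhoff_sum g n y\<bar> \<le> U k"
        proof (rule distortion_boundD[OF dist z(1) y(1)])
          show "z i = y i" if "i < n + Suc k" for i
            unfolding z_def using that yn s_head by (intro glue_agree[of "Suc k"]) auto
        qed
        moreover have "\<bar>birkhoff_sum g (Suc l) (periodize (Suc l) s) - birkhoff_sum g (Suc l) s\<bar> \<le> U k"
          and "birkhoff_sum g (Suc l) (periodize (Suc l) s) = 0"
        proof -
          have s_per: "s (Suc l + i) = s i" if "i < Suc k" for i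
            using fun_cong[OF s_tail, of "Suc i"] s_head[OF that] by (simp add: funpow_shift add_ac)
          have "periodize (Suc l) s \<in> loops E (s 0) (Suc l)"
            using s_per[of 0] s by (intro periodize_in_loops) auto
          note per = loopsD(1,2)[OF this]
          show "\<bar>birkhoff_sum g (Suc l) (periodize (Suc l) s) - birkhoff_sum g (Suc l) s\<bar> \<le> U k"
          proof (rule distortion_boundD[OF dist per(1) s])
            show "periodize (Suc l) s i = s i" if "i < Suc l + Suc k" for i
              using that s_per by (intro periodize_agree[of _ "Suc k"]) auto
          qed
          show "birkhoff_sum g (Suc l) (periodize (Suc l) s) = 0"
            using per by (intro zero) auto
        qed
        moreover have "birkhoff_sum g (Suc l) s = birkhoff_sum g l s + g x"
          using birkhoff_sum_add[of g l "Suc 0" s] s_tail by simp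
        moreover have "birkhoff_sum g (n + l) z = birkhoff_sum g n z + birkhoff_sum g l s"
          by (simp add: birkhoff_sum_add z_def)
        moreover have "birkhoff_sum g (n + l) z \<le> h x"
          using z z_tail by (intro upper) auto
        ultimately show ?thesis by linarith
      qed
      moreover have "(\<lambda>k. h x + g x + 2 * U k) \<longlonglongrightarrow> h x + g x + 2 * 0"
        by (intro tendsto_intros U0)
      ultimately show "birkhoff_sum g n y \<le> h x + g x"
        by (intro LIMSEQ_le_const[where X = "\<lambda>k. h x + g x + 2 * U k"]) auto
    qed
    ultimately show ?thesis by simp
  qed
  ultimately show ?thesis by blast
qed

end

section \<open>The asymptotic slopes\<close>

context pressure_family
begin

text \<open>Links all invariant measures to loops at the single state \<open>a\<close>, the only
  ones that the pressure sees.\<close>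

lemma integral_le_loop_averages:
  assumes \<beta>: "\<And>n x. n > 0 \<Longrightarrow> x \<in> loops E a n \<Longrightarrow> birkhoff_sum \<psi> n x \<le> real n * \<beta>"
    and \<mu>: "\<mu> \<in> invariant_measures E"
  shows "integral\<^sup>L \<mu> \<psi> \<le> \<beta>"
proof -
  interpret prob_space \<mu> using invariant_measuresD[OF \<mu>] by simp
  interpret \<psi>: distorted_potential E \<psi> U D
    using mix psi psi_le by unfold_locales
  interpret g: distorted_potential E "\<lambda>x. \<psi> x - \<beta>" U "D + \<bar>\<beta>\<bar>"
  proof
    show "\<bar>\<psi> x - \<beta>\<bar> \<le> D + \<bar>\<beta>\<bar>" if "x \<in> shift_space E" for x using psi_le[OF that] by linarith
  qed (use mix psi distortion_bound_diff_const in auto)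
  have "integral\<^sup>L \<mu> (\<lambda>x. \<psi> x - \<beta>) \<le> 0"
    using _ \<mu>
  proof (rule g.integral_nonpos)
    show "birkhoff_sum (\<lambda>x. \<psi> x - \<beta>) n x \<le> 0" if "n > 0" "x \<in> loops E a n" for n x
      using \<beta>[OF that] by (simp add: birkhoff_sum_diff_const)
  qed
  moreover have "integrable \<mu> \<psi>"
  proof -
    have "birkhoff_sum \<psi> (Suc 0) = \<psi>" by (simp add: fun_eq_iff)
    thus ?thesis using integral_birkhoff_sum(1)[OF \<mu> \<psi>.g_measurable psi_le, of "Suc 0"] by simp
  qed
  ultimately show ?thesis by (simp add: prob_space)
qed

text \<open>Provides the boundedness without which the real-valued supremum would carry no
  information.\<close>

lemma integral_le_D: "\<mu> \<in> invariant_measures E \<Longrightarrow> integral\<^sup>L \<mu> \<psi> \<le> D"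
proof (rule integral_le_loop_averages)
  show "birkhoff_sum \<psi> n x \<le> real n * D" if "n > 0" "x \<in> loops E a n" for n x
    using birkhoff_sum_abs_le[of x E \<psi> D n] psi_le loopsD(1)[OF that(2)] by auto
qed

lemma periodic_average_le_SUP:
  assumes "n > 0" "x \<in> shift_space E" "(shift ^^ n) x = x"
  shows "birkhoff_sum \<psi> n x / real n \<le> (SUP \<mu>\<in>invariant_measures E. integral\<^sup>L \<mu> \<psi>)"
proof -
  interpret \<psi>: distorted_potential E \<psi> U D
    using mix psi psi_le by unfold_locales
  obtain \<mu> where "\<mu> \<in> invariant_measures E" "integral\<^sup>L \<mu> \<psi> = birkhoff_sum \<psi> n x / real n"
    using periodic_invariant_measure[OF assms(2,3,1)] \<psi>.g_measurable by metis
  thus ?thesis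
    using integral_le_D by (metis (mono_tags, lifting) cSUP_upper bdd_aboveI2)
qed

lemma pressure_slope:
  defines "\<beta> \<equiv> (SUP \<mu>\<in>invariant_measures E. integral\<^sup>L \<mu> \<psi>)"
  shows "(right_deriv pressure \<longlongrightarrow> \<beta>) at_top" "(left_deriv pressure \<longlongrightarrow> \<beta>) at_top"
proof -
  have le: "birkhoff_sum \<psi> n x \<le> real n * \<beta>" if "n > 0" "x \<in> loops E a n" for n x
    using periodic_average_le_SUP[of n x] that loopsD(1,2)[OF that(2)]
    unfolding \<beta>_def by (simp add: field_simps)
  have upper: "pressure t \<le> pressure 0 + \<beta> * t" if "t \<ge> 0" for t
    using le that by (rule pressure_le)
  have lower: "\<exists>c'. \<forall>t\<ge>0. c' + \<beta>' * t \<le> pressure t" if "\<beta>' < \<beta>" for \<beta>'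
  proof -
    \<comment> \<open>A periodic orbit shows that invariant measures exist, as the choice of one
      with integral above \<open>\<beta>'\<close> requires.\<close>
    obtain N where N: "N > 0" "\<And>n. n \<ge> N \<Longrightarrow> loops E a n \<noteq> {}"
      using mixing_graph_loops_nonempty[OF mix] by blast
    obtain x where "x \<in> loops E a N" using N(2)[OF order_refl] by auto
    from loopsD(1,2)[OF this] obtain \<mu> where "\<mu> \<in> invariant_measures E"
      using periodic_invariant_measure[OF _ _ N(1)] by metis
    then obtain \<mu> where \<mu>: "\<mu> \<in> invariant_measures E" "\<beta>' < integral\<^sup>L \<mu> \<psi>"
      using less_cSupD[of "(\<lambda>\<mu>. integral\<^sup>L \<mu> \<psi>) ` invariant_measures E" \<beta>'] \<open>\<beta>' < \<beta>\<close>
      unfolding \<beta>_def by blast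
    \<comment> \<open>If all loop averages at \<open>a\<close> were at most \<open>\<beta>'\<close>,
      so would be the integral of \<open>\<mu>\<close>.\<close>
    have "\<exists>n x. n > 0 \<and> x \<in> loops E a n \<and> \<not> birkhoff_sum \<psi> n x \<le> real n * \<beta>'"
      using integral_le_loop_averages[OF _ \<mu>(1), of \<beta>'] \<mu>(2) by (metis not_less)
    then obtain n x where x: "n > 0" "x \<in> loops E a n" "\<not> birkhoff_sum \<psi> n x \<le> real n * \<beta>'"
      by blast
    have "birkhoff_sum \<phi> n x / real n + \<beta>' * t \<le> pressure t" if "t \<ge> 0" for t
    proof -
      have "\<beta>' \<le> birkhoff_sum \<psi> n x / real n" using x by (simp add: field_simps)
      hence "\<beta>' * t \<le> birkhoff_sum \<psi> n x / real n * t" using that by (rule mult_right_mono)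
      thus ?thesis using pressure_ge[OF x(1,2), of t] by (simp add: add_divide_distrib mult.commute)
    qed
    thus ?thesis by blast
  qed
  show "(right_deriv pressure \<longlongrightarrow> \<beta>) at_top"
    using convex_pressure upper lower by (rule convex_asymptotic_slope)
  show "(left_deriv pressure \<longlongrightarrow> \<beta>) at_top"
    using convex_pressure upper lower by (rule convex_asymptotic_slope)
qed

lemma pressure_family_minus: "pressure_family E a \<phi> (\<lambda>x. - \<psi> x) T U C D"
  using phi psi distortion_bound_minus phi_le psi_le by unfold_locales auto

lemma SUP_minus_eq_INF:
  "(SUP \<mu>\<in>invariant_measures E. integral\<^sup>L \<mu> (\<lambda>x. - \<psi> x))
    = - (INF \<mu>\<in>invariant_measures E. integral\<^sup>L \<mu> \<psi>)"
  by (simp add: Inf_real_def image_image)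

lemma pressure_slope_at_bot:
  defines "\<alpha> \<equiv> (INF \<mu>\<in>invariant_measures E. integral\<^sup>L \<mu> \<psi>)"
  shows "(right_deriv pressure \<longlongrightarrow> \<alpha>) at_bot" "(left_deriv pressure \<longlongrightarrow> \<alpha>) at_bot"
proof -
  interpret m: pressure_family E a \<phi> "\<lambda>x. - \<psi> x" T U C D
    by (rule pressure_family_minus)
  have "m.pressure = (\<lambda>t. pressure (- t))"
    by (simp add: fun_eq_iff m.pressure_def pressure_def)
  thus "(right_deriv pressure \<longlongrightarrow> \<alpha>) at_bot" "(left_deriv pressure \<longlongrightarrow> \<alpha>) at_bot"
    using convex_derivs_at_bot[OF convex_pressure, of "- \<alpha>"] m.pressure_slope
    unfolding SUP_minus_eq_INF \<alpha>_def by auto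
qed

text \<open>Otherwise every periodic average is squeezed between an infimum and a supremum that
  coincide. This covers periodic points through all states, as the construction of the transfer
  function demands.\<close>

lemma INF_less_SUP:
  assumes "\<not> cohomologous_to_const E \<psi>"
  shows "(INF \<mu>\<in>invariant_measures E. integral\<^sup>L \<mu> \<psi>) < (SUP \<mu>\<in>invariant_measures E. integral\<^sup>L \<mu> \<psi>)"
    (is "?\<alpha> < ?\<beta>")
proof (rule ccontr)
  assume not_less: "\<not> ?\<alpha> < ?\<beta>"
  interpret m: pressure_family E a \<phi> "\<lambda>x. - \<psi> x" T U C D
    by (rule pressure_family_minus)
  have zero: "birkhoff_sum (\<lambda>x. \<psi> x - ?\<beta>) n x = 0"
    if "n > 0" "x \<in> shift_space E" "(shift ^^ n) x = x" for n x
  proof -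
    have "birkhoff_sum \<psi> n x / real n = ?\<beta>"
      using periodic_average_le_SUP[OF that] m.periodic_average_le_SUP[OF that] not_less
      unfolding SUP_minus_eq_INF birkhoff_sum_minus by simp
    thus ?thesis using that by (simp add: birkhoff_sum_diff_const field_simps)
  qed
  interpret g: distorted_potential E "\<lambda>x. \<psi> x - ?\<beta>" U "D + \<bar>?\<beta>\<bar>"
  proof
    show "\<bar>\<psi> x - ?\<beta>\<bar> \<le> D + \<bar>?\<beta>\<bar>" if "x \<in> shift_space E" for x using psi_le[OF that] by linarith
  qed (use mix psi distortion_bound_diff_const in auto)
  have "\<exists>r. shift_continuous E r \<and> (\<forall>x\<in>shift_space E. \<psi> x - ?\<beta> = r x - r (shift x))"
    using zero by (rule g.coboundary_if_periodic_sums_vanish)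
  then obtain r where r: "shift_continuous E r"
    "\<And>x. x \<in> shift_space E \<Longrightarrow> \<psi> x - ?\<beta> = r x - r (shift x)"
    by blast
  have "\<psi> x = r x - r (shift x) + ?\<beta>" if "x \<in> shift_space E" for x
    using r(2)[OF that] by linarith
  thus False
    using assms r(1) unfolding cohomologous_to_const_def by blast
qed

end

theorem theorem3p2:
  fixes E :: "'a::countable \<Rightarrow> 'a \<Rightarrow> bool"
    and \<phi> \<psi> :: "(nat \<Rightarrow> 'a) \<Rightarrow> real"
    and a :: 'a
  assumes mix: "mixing_graph E"
    and fin_ent: "gurevich_pressure E (\<lambda>_. 0) a < \<infinity>"
    and sv_phi: "summable_variations E \<phi>"
    and sv_psi: "summable_variations E \<psi>"
    and sup_phi: "bdd_above (\<phi> ` shift_space E)"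
    and bdd_psi: "bounded (\<psi> ` shift_space E)"
  defines "p \<equiv> (\<lambda>t. real_of_ereal (gurevich_pressure E (\<lambda>x. \<phi> x + t * \<psi> x) a))"
  shows "(\<forall>t. \<bar>gurevich_pressure E (\<lambda>x. \<phi> x + t * \<psi> x) a\<bar> \<noteq> \<infinity>)
       \<and> convex_on UNIV p \<and> continuous_on UNIV p
       \<and> (\<forall>t. (\<exists>d. ((\<lambda>h. (p (t + h) - p t) / h) \<longlongrightarrow> d) (at_right 0))
            \<and> (\<exists>d. ((\<lambda>h. (p (t + h) - p t) / h) \<longlongrightarrow> d) (at_left 0)))
       \<and> (\<exists>Lp Lm.
            (right_deriv p \<longlongrightarrow> Lp) at_top \<and> (left_deriv p \<longlongrightarrow> Lp) at_top
          \<and> (right_deriv p \<longlongrightarrow> Lm) at_bot \<and> (left_deriv p \<longlongrightarrow> Lm) at_bot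
          \<and> Lp = (SUP \<mu> \<in> invariant_measures E. integral\<^sup>L \<mu> \<psi>)
          \<and> Lm = (INF \<mu> \<in> invariant_measures E. integral\<^sup>L \<mu> \<psi>)
          \<and> (\<not> cohomologous_to_const E \<psi> \<longrightarrow> Lm < Lp))"
proof -
  obtain T where T: "distortion_bound E \<phi> T"
    using summable_variations_distortion_bound[OF sv_phi] .
  obtain U where U: "distortion_bound E \<psi> U" "U \<longlonglongrightarrow> 0"
    using summable_variations_distortion_bound[OF sv_psi] .
  obtain C where C: "\<And>x. x \<in> shift_space E \<Longrightarrow> \<phi> x \<le> C"
    using sup_phi by (auto simp: bdd_above_def)
  obtain D where D: "\<And>x. x \<in> shift_space E \<Longrightarrow> \<bar>\<psi> x\<bar> \<le> D"
    using bdd_psi by (auto simp: bounded_iff)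
  interpret pressure_family E a \<phi> \<psi> T U C D
    using mix fin_ent T U C D by unfold_locales
  have p: "p = pressure"
    by (simp add: p_def pressure_def fun_eq_iff)
  have "\<forall>t. \<bar>gurevich_pressure E (\<lambda>x. \<phi> x + t * \<psi> x) a\<bar> \<noteq> \<infinity>"
    by (simp add: pressure_limit(1))
  moreover have "continuous_on UNIV pressure"
    using convex_pressure by (intro convex_on_continuous) auto
  ultimately show ?thesis
    unfolding p using convex_pressure convex_right_deriv(1)[OF convex_pressure]
      convex_left_deriv_reflect(1)[OF convex_pressure] pressure_slope pressure_slope_at_bot INF_less_SUP
    by blast
qed

end
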